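(* Let $d\in\mathbb{N}$ with $d\ge 1$. The following are equivalent for any graph class $\mathcal{C}$: 1. $\mathcal{C}$ has tree rank $d$; 2. there exists a function $g\colon \mathbb{N}\to \mathbb{N}$ such that, for every $r\in\mathbb{N}$, Splitter wins the $g(r)$-batched splitter game of radius $r$ in $d$ rounds, on any $G \in \mathcal{C}$. Moreover, $\mathcal{C}$ has elementary tree rank $d$ if and only if there is an elementary function $g\colon\mathbb{N}\to\mathbb{N}$ such that, for every $r\in\mathbb{N}$, Splitter wins the $g(r)$-batched splitter game of radius $r$ in $d$ rounds on any $G\in\mathcal{C}$.
   Context: Trees are rooted; the depth of a rooted tree is the maximal number of vertices on a root-to-leaf path. $T^d_k$ denotes the rooted tree of depth $d$ in which every non-leaf node has exactly $k$ children. A graph $H$ is an $r$-shallow topological minor of $G$ if $G$ contains as a subgraph a graph obtained from $H$ by replacing each edge by a path with at most $r$ internal vertices. The tree rank of a graph class $\mathcal{C}$ is the maximum $d$ such that for some $r\in\mathbb{N}$, every tree of depth $d$ is an $r$-shallow topological minor of some graph in $\mathcal{C}$; equivalently it is the least $d$ such that for every $r$ there is $k$ with $T^{d+1}_k$ not an $r$-shallow topological minor of any graph in $\mathcal{C}$. The elementary tree rank of $\mathcal{C}$ is the least $d$ such that there is an elementary function $f\colon\mathbb{N}\to\mathbb{N}$ with $T^{d+1}_{f(r)}$ not an $r$-shallow topological minor of any graph in $\mathcal{C}$, for every $r$. For $r,m\in\mathbb{N}$, the $m$-batched splitter game with radius $r$ on a graph $G$ is played by Splitter and Localiser: set $G_0:=G$;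 in round $i\ge 1$, Localiser picks a vertex $v\in G_{i-1}$ and sets $G'_{i-1}$ to be the subgraph of $G_{i-1}$ induced by the vertices at distance at most $r$ from $v$ in $G_{i-1}$; then Splitter removes at most $m$ vertices from $G'_{i-1}$ to obtain $G_i$. Splitter wins when $V(G_i)$ is empty.
   Formalization: "Has (elementary) tree rank d" is read as "has (elementary) tree rank at most d", since with exact rank the equivalence fails: a one-vertex graph class has tree rank 1 but Splitter also wins in 2 rounds. *)

theory Defs
  imports "Graph_Theory.Graph_Theory" "HOL-Library.Extended_Nat"
begin

text \<open>
  Finite simple graphs are \<^typ>\<open>('a, 'b) pre_digraph\<close> values satisfying the locale predicate
  \<^const>\<open>graph\<close>: every undirected edge is a pair of opposite arcs, and there are no loops and no
  parallel arcs.
\<close>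

section \<open>Elementary functions\<close>

text \<open>
  Kalmar's class of elementary functions: the least class containing zero, successor,
  projections and truncated subtraction that is closed under composition, bounded sums and
  bounded products. An \<open>n\<close>-ary function is applied to argument lists of length \<open>n\<close>.
\<close>

inductive kalmar_elementary :: "nat \<Rightarrow> (nat list \<Rightarrow> nat) \<Rightarrow> bool" where
  zero: "kalmar_elementary n (\<lambda>_. 0)"
| succ: "kalmar_elementary 1 (\<lambda>xs. Suc (xs ! 0))"
| proj: "i < n \<Longrightarrow> kalmar_elementary n (\<lambda>xs. xs ! i)"
| diff: "kalmar_elementary 2 (\<lambda>xs. xs ! 0 - xs ! 1)"
| comp: "kalmar_elementary m h \<Longrightarrow> length fs = m \<Longrightarrow> (\<And>f. f \<in> set fs \<Longrightarrow> kalmar_elementary n f)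
    \<Longrightarrow> kalmar_elementary n (\<lambda>xs. h (map (\<lambda>f. f xs) fs))"
| bsum: "kalmar_elementary (Suc n) f
    \<Longrightarrow> kalmar_elementary (Suc n) (\<lambda>xs. \<Sum>i\<le>hd xs. f (i # tl xs))"
| bprod: "kalmar_elementary (Suc n) f
    \<Longrightarrow> kalmar_elementary (Suc n) (\<lambda>xs. \<Prod>i\<le>hd xs. f (i # tl xs))"

definition elementary :: "(nat \<Rightarrow> nat) \<Rightarrow> bool" where
  "elementary f \<longleftrightarrow> (\<exists>F. kalmar_elementary 1 F \<and> (\<forall>n. f n = F [n]))"


section \<open>Rooted trees\<close>

text \<open>
  The library's \<^const>\<open>forest\<close> (hence \<^const>\<open>tree\<close>) is unsuitable here: in a symmetric digraph the two
  arcs of a single edge already form a directed cycle. Cycles of the underlying undirected graph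
  have at least three vertices.
\<close>

definition undirected_acyclic :: "('a, 'b) pre_digraph \<Rightarrow> bool" where
  "undirected_acyclic T \<longleftrightarrow> \<not> (\<exists>p. vpath p T \<and> length p \<ge> 3 \<and> last p \<rightarrow>\<^bsub>T\<^esub> hd p)"

definition rooted_tree :: "('a, 'b) pre_digraph \<Rightarrow> 'a \<Rightarrow> bool" where
  "rooted_tree T \<rho> \<longleftrightarrow>
    graph T \<and> connected T \<and> undirected_acyclic T \<and> \<rho> \<in> verts T"

text \<open>
  A leaf is a node without children. Since \<^const>\<open>out_degree\<close> is the number of neighbours, and
  every node other than the root has exactly one neighbour that is not its child, this is a
  condition on the degree.
\<close>

definition tree_leaf :: "('a, 'b) pre_digraph \<Rightarrow> 'a \<Rightarrow> 'a \<Rightarrow> bool" where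
  "tree_leaf T \<rho> v \<longleftrightarrow> v \<in> verts T \<and> out_degree T v = (if v = \<rho> then 0 else 1)"

definition tree_depth :: "('a, 'b) pre_digraph \<Rightarrow> 'a \<Rightarrow> nat" where
  "tree_depth T \<rho> = Max {length p | p. vpath p T \<and> hd p = \<rho> \<and> tree_leaf T \<rho> (last p)}"

text \<open>
  The tree \<open>T\<^sup>d\<^sub>k\<close>, with all leaves at depth \<open>d \<ge> 1\<close>. A node is the reversed list of child indices
  on the way from the root \<open>[]\<close>, so the children of \<open>xs\<close> are the nodes \<open>i # xs\<close> with \<open>i < k\<close>.
  For \<open>k = 0\<close> this is a single node.
\<close>

definition complete_tree :: "nat \<Rightarrow> nat \<Rightarrow> (nat list, nat list \<times> nat list) pre_digraph" where
  "complete_tree d k =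
    (let V = {xs. length xs < d \<and> set xs \<subseteq> {..<k}}
     in with_proj \<lparr> pverts = V,
          parcs = {(xs, ys) \<in> V \<times> V. \<exists>i. ys = i # xs \<or> xs = i # ys} \<rparr>)"


section \<open>Shallow topological minors and tree rank\<close>

definition inner_vertices :: "'a vwalk \<Rightarrow> 'a list" where
  "inner_vertices p = butlast (tl p)"

text \<open>
  \<open>\<phi>\<close> places the vertices of \<open>H\<close> in \<open>G\<close>, and \<open>P u v\<close> is the path of \<open>G\<close> replacing the edge \<open>uv\<close>;
  the equation \<open>P v u = rev (P u v)\<close> makes it a path for the undirected edge.
\<close>

definition shallow_topological_minor ::
  "nat \<Rightarrow> ('c, 'd) pre_digraph \<Rightarrow> ('a, 'b) pre_digraph \<Rightarrow> bool" where
  "shallow_topological_minor r H G \<longleftrightarrow>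
    (\<exists>\<phi> P. inj_on \<phi> (verts H) \<and> \<phi> ` verts H \<subseteq> verts G \<and>
      (\<forall>u v. u \<rightarrow>\<^bsub>H\<^esub> v \<longrightarrow>
        vpath (P u v) G \<and> hd (P u v) = \<phi> u \<and> last (P u v) = \<phi> v \<and>
        P v u = rev (P u v) \<and>
        length (inner_vertices (P u v)) \<le> r \<and>
        set (inner_vertices (P u v)) \<inter> \<phi> ` verts H = {}) \<and>
      (\<forall>u v x y. u \<rightarrow>\<^bsub>H\<^esub> v \<and> x \<rightarrow>\<^bsub>H\<^esub> y \<and> {u, v} \<noteq> {x, y} \<longrightarrow>
        set (inner_vertices (P u v)) \<inter> set (inner_vertices (P x y)) = {}))"

text \<open>
  Every finite tree is isomorphic to one on natural numbers with pairs as arcs, so these represent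
  all trees. The supremum is the maximum of a set that always contains \<open>0\<close>, as no rooted tree has
  depth \<open>0\<close>, and it is \<open>\<infinity>\<close> if that set is unbounded.
\<close>

definition tree_rank :: "('a, 'b) pre_digraph set \<Rightarrow> enat" where
  "tree_rank C = Sup {enat d | d. \<exists>r. \<forall>(T :: (nat, nat \<times> nat) pre_digraph) \<rho>.
     rooted_tree T \<rho> \<and> tree_depth T \<rho> = d \<longrightarrow> (\<exists>G\<in>C. shallow_topological_minor r T G)}"

text \<open>The infimum is the least element, or \<open>\<infinity>\<close> if there is no such \<open>d\<close>.\<close>

definition elementary_tree_rank :: "('a, 'b) pre_digraph set \<Rightarrow> enat" where
  "elementary_tree_rank C = Inf {enat d | d. \<exists>f. elementary f \<and>
     (\<forall>r. \<forall>G\<in>C. \<not> shallow_topological_minor r (complete_tree (d + 1) (f r)) G)}"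


section \<open>The batched splitter game\<close>

text \<open>With unit weights, \<open>\<mu>\<close> is the graph distance (\<open>\<infinity>\<close> between different components).\<close>

definition gball :: "('a, 'b) pre_digraph \<Rightarrow> nat \<Rightarrow> 'a \<Rightarrow> 'a set" where
  "gball G r v = {u \<in> verts G. wf_digraph.\<mu> G (\<lambda>_. 1) v u \<le> ereal (real r)}"

text \<open>
  \<open>splitter_wins m r n G\<close>: Splitter can force, in at most \<open>n\<close> rounds of the \<open>m\<close>-batched game of radius
  \<open>r\<close> started on \<open>G\<close>, that the current graph has no vertices. If \<open>G\<close> is already empty, the
  quantification over Localiser's moves is vacuous.
\<close>

primrec splitter_wins :: "nat \<Rightarrow> nat \<Rightarrow> nat \<Rightarrow> ('a, 'b) pre_digraph \<Rightarrow> bool" where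
  "splitter_wins m r 0 G \<longleftrightarrow> verts G = {}"
| "splitter_wins m r (Suc n) G \<longleftrightarrow>
    (\<forall>v\<in>verts G. let G' = G \<restriction> gball G r v in
      \<exists>S\<subseteq>verts G'. finite S \<and> card S \<le> m \<and> splitter_wins m r n (G' \<restriction> (verts G' - S)))"

end

theory Submission
  imports Defs
begin

text \<open>
  Let \<open>T\<close> be \<open>T\<^sup>d\<^sup>+\<^sup>1\<^sub>k\<close> with each edge replaced by a path with at most \<open>r\<close> internal vertices. If a
  graph contains \<open>T\<close>, Localiser plays the root with radius \<open>d * (r + 1)\<close>. The ball contains all of
  \<open>T\<close>, and as \<open>T\<close> has \<open>k\<close> disjoint branches, one of them survives the removal of fewer than \<open>k\<close>
  vertices. So Splitter does not win in \<open>d\<close> rounds.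

  Conversely, suppose that the graph contains no such \<open>T\<close> and Localiser picks a ball of radius \<open>r\<close>.
  Splitter removes the vertices of a maximal family of disjoint subdivided copies of \<open>T\<^sup>d\<^sub>k\<^sub>+\<^sub>r\<close>
  in the ball, so that no such copy remains, and the argument is repeated for \<open>d - 1\<close> and \<open>k + r\<close>.
  The family is small: the roots of a large family are all within distance \<open>r\<close> of one vertex,
  so many of them are the ends of the arms of a subdivided star with short arms. An arm meets few
  of the trees, so after passing to an independent set of a conflict graph each arm meets only its
  own tree. After discarding the at most \<open>r\<close> branches at each root that the arm meets, star and trees
  form a copy of \<open>T\<close>. For fixed \<open>d\<close> all bounds are elementary in \<open>k\<close> and \<open>r\<close>.
\<close>

section \<open>Subdivided trees\<close>

text \<open>Every round replaces the graph by a ball without Splitter's batch, so the combinatorics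
  is stated for one fixed relation \<open>E\<close> and a varying vertex set \<open>W\<close>;
  digraphs return only in the later sections.

  In the converse, Localiser's vertex need not be the centre of a large star: its short paths to the
  roots may all run through a few bottleneck vertices. One bottleneck is then within one edge less
  of many of the roots and takes over as centre. This can repeat at most \<open>r\<close> times,
  whence the power in \<open>family_bound\<close>.

  The arms of the star may cross the trees in two ways. An arm that meets a foreign tree is avoided
  by choosing a subfamily. An arm that meets its own tree cannot be avoided in this way; hence the
  \<open>r\<close> spare children, which absorb the loss of the branches that are met. The surplus
  adds up to \<open>k + i * r\<close> after \<open>i\<close> rounds, while the depth falls until the
  forbidden tree is a single vertex and the graph must be empty.\<close>

definition vpath_on :: "('a \<Rightarrow> 'a \<Rightarrow> bool) \<Rightarrow> 'a set \<Rightarrow> 'a list \<Rightarrow> bool" where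
  "vpath_on E W p \<longleftrightarrow> p \<noteq> [] \<and> distinct p \<and> set p \<subseteq> W \<and> successively E p"

text \<open>Walks instead of paths, because the distance behind \<open>gball\<close> is an infimum
  over walks. Lists count vertices, so radius \<open>r\<close> becomes length
  \<open>Suc r\<close>.\<close>

definition walk_ball :: "('a \<Rightarrow> 'a \<Rightarrow> bool) \<Rightarrow> 'a set \<Rightarrow> nat \<Rightarrow> 'a \<Rightarrow> 'a set" where
  "walk_ball E W r v = {u. \<exists>p. p \<noteq> [] \<and> set p \<subseteq> W \<and> successively E p \<and> hd p = v \<and> last p = u \<and>
     length p \<le> Suc r}"

lemma vpath_on_mono: "vpath_on E W p \<Longrightarrow> set p \<subseteq> W' \<Longrightarrow> vpath_on E W' p"
  by (auto simp: vpath_on_def)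

lemma vpath_on_suffix: "vpath_on E W (p @ q) \<Longrightarrow> q \<noteq> [] \<Longrightarrow> vpath_on E W q"
  by (auto simp: vpath_on_def successively_append_iff)

text \<open>Cutting out the piece between two occurrences of a vertex shortens the walk and keeps
  its ends.\<close>

lemma walk_to_vpath_on:
  assumes "p \<noteq> []" "set p \<subseteq> W" "successively E p"
  shows "\<exists>q. vpath_on E W q \<and> hd q = hd p \<and> last q = last p \<and> length q \<le> length p"
  using assms
proof (induction "length p" arbitrary: p rule: less_induct)
  case less
  show ?case
  proof (cases "distinct p")
    case True
    with less.prems show ?thesis by (auto simp: vpath_on_def)
  next
    case False
    then obtain xs ys zs y where p: "p = xs @ [y] @ ys @ [y] @ zs"
      using not_distinct_decomp by blast
    let ?q = "xs @ [y] @ zs"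
    have "\<exists>q. vpath_on E W q \<and> hd q = hd ?q \<and> last q = last ?q \<and> length q \<le> length ?q"
      using less.prems p by (intro less.hyps) (auto simp: successively_append_iff successively_Cons)
    moreover have "hd ?q = hd p" "last ?q = last p" "length ?q \<le> length p"
      using p by (auto simp: hd_append)
    ultimately show ?thesis
      by (metis le_trans)
  qed
qed

lemma walk_ball_vpath_onE:
  assumes "u \<in> walk_ball E W r v"
  obtains p where "vpath_on E W p" "hd p = v" "last p = u" "length p \<le> Suc r"
proof -
  from assms obtain p where p: "p \<noteq> []" "set p \<subseteq> W" "successively E p" "hd p = v" "last p = u"
    "length p \<le> Suc r"
    unfolding walk_ball_def by blast
  show ?thesis
    using walk_to_vpath_on[OF p(1-3)] p(4-6) that order.trans by metis
qed

lemma walk_ball_subset: "walk_ball E W r v \<subseteq> W"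
  unfolding walk_ball_def by (auto dest: last_in_set)

text \<open>
  \<open>sdtree E r k W d v A\<close>: the induced subgraph on \<open>W\<close> contains, with root \<open>v\<close> and vertex set \<open>A\<close>, a
  copy of \<open>T\<^sup>d\<^sup>+\<^sup>1\<^sub>k\<close> whose edges are replaced by paths with at most \<open>r\<close> internal vertices.
\<close>

primrec sdtree ::
  "('a \<Rightarrow> 'a \<Rightarrow> bool) \<Rightarrow> nat \<Rightarrow> nat \<Rightarrow> 'a set \<Rightarrow> nat \<Rightarrow> 'a \<Rightarrow> 'a set \<Rightarrow> bool" where
  "sdtree E r k W 0 v A \<longleftrightarrow> v \<in> W \<and> A = {v}"
| "sdtree E r k W (Suc d) v A \<longleftrightarrow> v \<in> W \<and> (\<exists>w P B.
     (\<forall>i<k. vpath_on E W (P i) \<and> hd (P i) = v \<and> last (P i) = w i \<and> v \<noteq> w i \<and>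
        length (P i) \<le> r + 2 \<and> sdtree E r k W d (w i) (B i) \<and> set (P i) \<inter> B i = {w i}) \<and>
     (\<forall>i<k. \<forall>j<k. i \<noteq> j \<longrightarrow> (set (P i) \<union> B i) \<inter> (set (P j) \<union> B j) = {v}) \<and>
     A = insert v (\<Union>i<k. set (P i) \<union> B i))"

lemma sdtree_SucE:
  assumes "sdtree E r k W (Suc d) v A"
  obtains w P B where "v \<in> W"
    "\<And>i. i < k \<Longrightarrow> vpath_on E W (P i) \<and> hd (P i) = v \<and> last (P i) = w i \<and> v \<noteq> w i \<and>
        length (P i) \<le> r + 2 \<and> sdtree E r k W d (w i) (B i) \<and> set (P i) \<inter> B i = {w i}"
    "\<And>i j. i < k \<Longrightarrow> j < k \<Longrightarrow> i \<noteq> j \<Longrightarrow> (set (P i) \<union> B i) \<inter> (set (P j) \<union> B j) = {v}"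
    "A = insert v (\<Union>i<k. set (P i) \<union> B i)"
  using assms unfolding sdtree.simps
proof (elim conjE exE, goal_cases)
  case (1 w P B)
  show ?case by (rule that[of P w B]) (use 1 in blast)+
qed

lemma sdtree_SucI:
  assumes "v \<in> W"
    "\<And>i. i < k \<Longrightarrow> vpath_on E W (P i) \<and> hd (P i) = v \<and> last (P i) = w i \<and> v \<noteq> w i \<and>
        length (P i) \<le> r + 2 \<and> sdtree E r k W d (w i) (B i) \<and> set (P i) \<inter> B i = {w i}"
    "\<And>i j. i < k \<Longrightarrow> j < k \<Longrightarrow> i \<noteq> j \<Longrightarrow> (set (P i) \<union> B i) \<inter> (set (P j) \<union> B j) = {v}"
    "A = insert v (\<Union>i<k. set (P i) \<union> B i)"
  shows "sdtree E r k W (Suc d) v A"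
proof -
  have "\<forall>i<k. vpath_on E W (P i) \<and> hd (P i) = v \<and> last (P i) = w i \<and> v \<noteq> w i \<and>
        length (P i) \<le> r + 2 \<and> sdtree E r k W d (w i) (B i) \<and> set (P i) \<inter> B i = {w i}"
    using assms(2) by (intro allI impI)
  moreover have "\<forall>i<k. \<forall>j<k. i \<noteq> j \<longrightarrow> (set (P i) \<union> B i) \<inter> (set (P j) \<union> B j) = {v}"
    using assms(3) by (intro allI impI)
  ultimately show ?thesis
    unfolding sdtree.simps using assms(1,4)
    by (intro conjI exI[of _ w] exI[of _ P] exI[of _ B])
qed

lemma sdtree_root: "sdtree E r k W d v A \<Longrightarrow> v \<in> A"
  by (cases d) auto

lemma sdtree_subset: "sdtree E r k W d v A \<Longrightarrow> A \<subseteq> W"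
proof (induction d arbitrary: v A)
  case (Suc d)
  then obtain w P B where "v \<in> W" "A = insert v (\<Union>i<k. set (P i) \<union> B i)"
    and "\<And>i. i < k \<Longrightarrow> vpath_on E W (P i) \<and> sdtree E r k W d (w i) (B i)"
    by (elim sdtree_SucE) blast
  with Suc.IH show ?case unfolding vpath_on_def by blast
qed auto

lemma sdtree_finite: "sdtree E r k W d v A \<Longrightarrow> finite A"
proof (induction d arbitrary: v A)
  case (Suc d)
  then obtain w P B where "A = insert v (\<Union>i<k. set (P i) \<union> B i)"
    and "\<And>i. i < k \<Longrightarrow> sdtree E r k W d (w i) (B i)"
    by (elim sdtree_SucE) blast
  with Suc.IH show ?case by auto
qed auto

text \<open>\<open>W\<close> only has to contain the paths and roots, and all of these lie in
  \<open>A\<close>. This moves a tree between a ball, a ball without a batch and the whole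
  graph.\<close>

lemma sdtree_change_set:
  assumes "sdtree E r k W d v A" "A \<subseteq> W'"
  shows "sdtree E r k W' d v A"
  using assms
proof (induction d arbitrary: v A)
  case (Suc d)
  then obtain w P B where *:
     "\<And>i. i < k \<Longrightarrow> vpath_on E W (P i) \<and> hd (P i) = v \<and> last (P i) = w i \<and> v \<noteq> w i \<and>
        length (P i) \<le> r + 2 \<and> sdtree E r k W d (w i) (B i) \<and> set (P i) \<inter> B i = {w i}"
     "\<And>i j. i < k \<Longrightarrow> j < k \<Longrightarrow> i \<noteq> j \<Longrightarrow> (set (P i) \<union> B i) \<inter> (set (P j) \<union> B j) = {v}"
     "A = insert v (\<Union>i<k. set (P i) \<union> B i)"
    by (elim sdtree_SucE) blast
  have "set (P i) \<subseteq> W'" "B i \<subseteq> W'" if "i < k" for i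
    using *(3) Suc.prems(2) that by auto
  then have "vpath_on E W' (P i) \<and> hd (P i) = v \<and> last (P i) = w i \<and> v \<noteq> w i \<and>
        length (P i) \<le> r + 2 \<and> sdtree E r k W' d (w i) (B i) \<and> set (P i) \<inter> B i = {w i}" if "i < k" for i
    using *(1)[OF that] Suc.IH vpath_on_mono that by metis
  moreover have "v \<in> W'" using *(3) Suc.prems(2) by auto
  ultimately show ?case using *(2,3) by (intro sdtree_SucI[of _ _ _ _ P w r d B])
qed auto

text \<open>
  The branches at the root are disjoint outside \<open>v\<close>, so \<open>F\<close> hits at most \<open>c\<close> of them. The induction
  is only needed to lower the branching below the root.
\<close>

lemma sdtree_prune:
  assumes "sdtree E r (k + c) W d v A" "finite F" "card (F - {v}) \<le> c"
  shows "\<exists>A'\<subseteq>A. sdtree E r k W d v A' \<and> A' \<inter> F \<subseteq> {v}"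
  using assms
proof (induction d arbitrary: v A F)
  case (Suc d)
  from Suc.prems(1) obtain w P B where *:
     "\<And>i. i < k + c \<Longrightarrow> vpath_on E W (P i) \<and> hd (P i) = v \<and> last (P i) = w i \<and> v \<noteq> w i \<and>
        length (P i) \<le> r + 2 \<and> sdtree E r (k + c) W d (w i) (B i) \<and> set (P i) \<inter> B i = {w i}"
     "\<And>i j. i < k + c \<Longrightarrow> j < k + c \<Longrightarrow> i \<noteq> j \<Longrightarrow> (set (P i) \<union> B i) \<inter> (set (P j) \<union> B j) = {v}"
     "A = insert v (\<Union>i<k+c. set (P i) \<union> B i)" "v \<in> W"
    by (elim sdtree_SucE) blast
  let ?C = "\<lambda>i. set (P i) \<union> B i"
  define bad where "bad = {i. i < k + c \<and> ?C i \<inter> (F - {v}) \<noteq> {}}"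
  \<comment> \<open>\<open>h\<close> picks a vertex of \<open>F - {v}\<close> in every branch that
    is hit. Branches share only \<open>v\<close>, so \<open>h\<close> is injective and there are at
    most \<open>c\<close> such branches.\<close>
  have "\<forall>i\<in>bad. \<exists>x. x \<in> ?C i \<inter> (F - {v})"
    unfolding bad_def by blast
  then obtain h where h: "\<And>i. i \<in> bad \<Longrightarrow> h i \<in> ?C i \<inter> (F - {v})"
    by metis
  have "inj_on h bad"
  proof (rule inj_onI, rule ccontr)
    fix i j assume ij: "i \<in> bad" "j \<in> bad" "h i = h j" "i \<noteq> j"
    then have "h i \<in> ?C i \<inter> ?C j" "h i \<noteq> v" using h[of i] h[of j] by auto
    with *(2)[of i j] ij show False by (auto simp: bad_def)
  qed
  moreover have "h ` bad \<subseteq> F - {v}" using h by blast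
  ultimately have "card bad \<le> c"
    using Suc.prems(2,3) by (metis card_inj_on_le finite_Diff le_trans)
  moreover have fb: "finite bad" "bad \<subseteq> {..<k+c}" by (auto simp: bad_def)
  ultimately have "k \<le> card ({..<k+c} - bad)"
    by (simp add: card_Diff_subset)
  then obtain J where J: "J \<subseteq> {..<k+c} - bad" "card J = k" "finite J"
    using obtain_subset_with_card_n by blast
  then obtain e where e: "bij_betw e {..<k} J"
    by (metis bij_betw_from_nat_into_finite)
  then have eJ: "\<And>i. i < k \<Longrightarrow> e i \<in> J" and einj: "\<And>i j. i < k \<Longrightarrow> j < k \<Longrightarrow> i \<noteq> j \<Longrightarrow> e i \<noteq> e j"
    by (auto simp: bij_betw_def inj_on_def)
  have ek: "e i < k + c" and eF: "?C (e i) \<inter> F \<subseteq> {v}" if "i < k" for i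
    using eJ[OF that] J(1) by (auto simp: bad_def)
  have "\<exists>B'\<subseteq>B (e i). sdtree E r k W d (w (e i)) B'" if "i < k" for i
    using Suc.IH[of "w (e i)" "B (e i)" "{}"] *(1)[OF ek[OF that]] by auto
  then obtain B' where B': "\<And>i. i < k \<Longrightarrow> B' i \<subseteq> B (e i) \<and> sdtree E r k W d (w (e i)) (B' i)"
    by metis
  let ?P = "P \<circ> e" and ?w = "w \<circ> e"
  let ?A = "insert v (\<Union>i<k. set (?P i) \<union> B' i)"
  have 1: "vpath_on E W (?P i) \<and> hd (?P i) = v \<and> last (?P i) = ?w i \<and> v \<noteq> ?w i \<and>
        length (?P i) \<le> r + 2 \<and> sdtree E r k W d (?w i) (B' i) \<and> set (?P i) \<inter> B' i = {?w i}"
    if i: "i < k" for i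
  proof -
    have "set (?P i) \<inter> B' i = {?w i}"
      using *(1)[OF ek[OF i]] B'[OF i] sdtree_root[of E r k W d "w (e i)" "B' i"] by auto
    then show ?thesis
      using *(1)[OF ek[OF i]] B'[OF i] by simp
  qed
  have 2: "(set (?P i) \<union> B' i) \<inter> (set (?P j) \<union> B' j) = {v}" if "i < k" "j < k" "i \<noteq> j" for i j
  proof -
    have "v \<in> set (?P i)" "v \<in> set (?P j)"
      using *(1)[OF ek[OF that(1)]] *(1)[OF ek[OF that(2)]] unfolding vpath_on_def comp_def
      by (metis hd_in_set)+
    then show ?thesis
      using *(2)[OF ek[OF that(1)] ek[OF that(2)] einj[OF that]] B'[OF that(1)] B'[OF that(2)]
      by auto
  qed
  have "sdtree E r k W (Suc d) v ?A"
    using 1 2 *(4) by (intro sdtree_SucI[of _ _ _ _ ?P ?w r d B'] refl)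
  moreover have "?A \<subseteq> A" using *(3) B' ek by fastforce
  moreover have "?A \<inter> F \<subseteq> {v}" using eF B' by fastforce
  ultimately show ?case by blast
qed auto

text \<open>A crude upper bound: a path is charged with all of its \<open>r + 2\<close> vertices
  although both ends are also counted elsewhere.\<close>

primrec sdtree_size :: "nat \<Rightarrow> nat \<Rightarrow> nat \<Rightarrow> nat" where
  "sdtree_size r k 0 = 1"
| "sdtree_size r k (Suc d) = 1 + k * (r + 2 + sdtree_size r k d)"

lemma card_sdtree: "sdtree E r k W d v A \<Longrightarrow> card A \<le> sdtree_size r k d"
proof (induction d arbitrary: v A)
  case (Suc d)
  then obtain w P B where *:
     "\<And>i. i < k \<Longrightarrow> length (P i) \<le> r + 2 \<and> sdtree E r k W d (w i) (B i)"
     "A = insert v (\<Union>i<k. set (P i) \<union> B i)"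
    by (elim sdtree_SucE) blast
  have "card (set (P i) \<union> B i) \<le> r + 2 + sdtree_size r k d" if "i < k" for i
    using *(1)[OF that] Suc.IH[of "w i" "B i"] card_Un_le[of "set (P i)" "B i"] card_length[of "P i"]
    by linarith
  then have "(\<Sum>i<k. card (set (P i) \<union> B i)) \<le> k * (r + 2 + sdtree_size r k d)"
    using sum_bounded_above[of "{..<k}" "\<lambda>i. card (set (P i) \<union> B i)" "r + 2 + sdtree_size r k d"]
    by simp
  moreover have "card (\<Union>i<k. set (P i) \<union> B i) \<le> (\<Sum>i<k. card (set (P i) \<union> B i))"
    by (rule card_UN_le) simp
  moreover have "card A \<le> Suc (card (\<Union>i<k. set (P i) \<union> B i))"
    unfolding *(2) by (rule card_insert_le_m1) simp_all
  ultimately show ?case by simp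
qed auto

section \<open>Disjoint trees in a ball\<close>

text \<open>Greedy choice in the digraph with arcs from \<open>i\<close> to \<open>f i\<close>.
  Outdegrees are at most \<open>D\<close>, hence so is the average indegree, and some
  \<open>j\<close> has indegree at most \<open>D\<close>. Taking \<open>j\<close> costs at most
  \<open>2 * D + 1\<close> vertices: itself and its neighbours in both directions.\<close>

lemma independent_subset:
  assumes "finite I" "\<And>i. i \<in> I \<Longrightarrow> card (f i \<inter> I) \<le> D"
  shows "\<exists>J\<subseteq>I. card I \<le> (2 * D + 1) * card J \<and> (\<forall>i\<in>J. \<forall>j\<in>J. i \<noteq> j \<longrightarrow> j \<notin> f i)"
  using assms
proof (induction "card I" arbitrary: I rule: less_induct)
  case less
  show ?case
  proof (cases "I = {}")
    case True
    then show ?thesis by auto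
  next
    case False
    let ?in = "\<lambda>j. {i \<in> I. j \<in> f i}"
    have "(\<Sum>j\<in>I. card (?in j)) = (\<Sum>j\<in>I. \<Sum>i\<in>I. if j \<in> f i then 1 else 0)"
      using less.prems(1) by (intro sum.cong refl) (simp add: sum.If_cases Int_def)
    also have "\<dots> = (\<Sum>i\<in>I. \<Sum>j\<in>I. if j \<in> f i then 1 else 0)" by (rule sum.swap)
    also have "\<dots> = (\<Sum>i\<in>I. card (f i \<inter> I))"
      using less.prems(1) by (intro sum.cong refl) (simp add: sum.If_cases Int_def conj_commute)
    also have "\<dots> \<le> card I * D"
      using sum_bounded_above[of I "\<lambda>i. card (f i \<inter> I)" D] less.prems(2) by simp
    finally have "(\<Sum>j\<in>I. card (?in j)) \<le> card I * D" .
    moreover have "card I * Suc D \<le> (\<Sum>j\<in>I. card (?in j))" if "\<forall>j\<in>I. D < card (?in j)"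
      using sum_bounded_below[of I "Suc D" "\<lambda>j. card (?in j)"] that by (simp add: Suc_le_eq)
    moreover have "card I > 0" using False less.prems(1) by (simp add: card_gt_0_iff)
    ultimately obtain j where j: "j \<in> I" "card (?in j) \<le> D"
      by (metis (no_types, lifting) add_le_same_cancel2 le_trans mult_Suc_right not_le)
    define R where "R = insert j (f j \<inter> I \<union> ?in j)"
    let ?I = "I - R"
    have RI: "R \<subseteq> I" "finite R" using j(1) less.prems(1) by (auto simp: R_def intro: finite_subset)
    have "card R \<le> Suc (card (f j \<inter> I \<union> ?in j))"
      unfolding R_def by (rule card_insert_le_m1) simp_all
    also have "\<dots> \<le> 2 * D + 1"
      using card_Un_le[of "f j \<inter> I" "?in j"] less.prems(2)[OF j(1)] j(2) by linarith
    finally have R: "card R \<le> 2 * D + 1" .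
    have "j \<notin> ?I" by (simp add: R_def)
    then have "card ?I < card I" using j(1) less.prems(1) by (intro psubset_card_mono) auto
    moreover have "card (f i \<inter> ?I) \<le> D" if "i \<in> ?I" for i
    proof -
      have "card (f i \<inter> ?I) \<le> card (f i \<inter> I)" using less.prems(1) by (intro card_mono) auto
      also have "\<dots> \<le> D" using less.prems(2) that by simp
      finally show ?thesis .
    qed
    ultimately obtain J where J: "J \<subseteq> ?I" "card ?I \<le> (2 * D + 1) * card J"
      "\<forall>i\<in>J. \<forall>i'\<in>J. i \<noteq> i' \<longrightarrow> i' \<notin> f i"
      using less.hyps[of ?I] less.prems(1) by auto
    have "finite J" "j \<notin> J" using J(1) less.prems(1) \<open>j \<notin> ?I\<close> by (auto intro: finite_subset)
    then have "card (insert j J) = Suc (card J)" by simp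
    moreover have "card I = card ?I + card R"
      using RI by (simp add: card_Diff_subset card_mono less.prems(1))
    ultimately have "card I \<le> (2 * D + 1) * card (insert j J)"
      using J(2) R by simp
    moreover have "\<forall>i\<in>insert j J. \<forall>i'\<in>insert j J. i \<noteq> i' \<longrightarrow> i' \<notin> f i"
      using J(1,3) unfolding R_def by blast
    moreover have "insert j J \<subseteq> I" using J(1) j(1) by blast
    ultimately show ?thesis by blast
  qed
qed

definition path_star ::
  "('a \<Rightarrow> 'a \<Rightarrow> bool) \<Rightarrow> 'a set \<Rightarrow> nat \<Rightarrow> 'a \<Rightarrow> 'a set \<Rightarrow> ('a \<Rightarrow> 'a list) \<Rightarrow> bool" where
  "path_star E W l u Y P \<longleftrightarrow>
     (\<forall>y\<in>Y. y \<noteq> u \<and> vpath_on E W (P y) \<and> hd (P y) = u \<and> last (P y) = y \<and> length (P y) \<le> Suc l) \<and>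
     (\<forall>y\<in>Y. \<forall>y'\<in>Y. y \<noteq> y' \<longrightarrow> set (P y) \<inter> set (P y') = {u})"

text \<open>
  Take a maximal family of paths from \<open>v\<close> to \<open>X\<close> that are disjoint outside \<open>v\<close>. If it has fewer than
  \<open>K\<close> members, their vertices block \<open>v\<close> from \<open>X\<close>, so one of them is at distance at most \<open>j - 1\<close>
  from a large part of \<open>X\<close>.
\<close>

lemma ball_contains_star:
  assumes "finite X" "j \<le> R" "(K * R + 1) ^ j < card X"
    and "\<And>x. x \<in> X \<Longrightarrow> \<exists>p. vpath_on E W p \<and> hd p = v \<and> last p = x \<and> length p \<le> Suc j"
  shows "\<exists>u Y P. Y \<subseteq> X \<and> card Y = K \<and> path_star E W R u Y P"
  using assms
proof (induction j arbitrary: v X)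
  case 0
  \<comment> \<open>At distance 0 only \<open>v\<close> is reachable, which contradicts
    \<open>1 < card X\<close>.\<close>
  have "x = v" if "x \<in> X" for x
  proof -
    from 0(4)[OF that] obtain p where "vpath_on E W p" "hd p = v" "last p = x" "length p \<le> 1" by auto
    then show ?thesis by (cases p) (auto simp: vpath_on_def)
  qed
  then have "card X \<le> card {v}" by (intro card_mono) auto
  with 0 show ?case by simp
next
  case (Suc j)
  define fam where "fam Y P \<longleftrightarrow> Y \<subseteq> X \<and>
     (\<forall>y\<in>Y. y \<noteq> v \<and> vpath_on E W (P y) \<and> hd (P y) = v \<and> last (P y) = y \<and> length (P y) \<le> Suc (Suc j)) \<and>
     (\<forall>y\<in>Y. \<forall>y'\<in>Y. y \<noteq> y' \<longrightarrow> set (P y) \<inter> set (P y') = {v})" for Y and P :: "'a \<Rightarrow> 'a list"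
  let ?M = "K * R + 1"
  have "fam {} (\<lambda>_. [])" by (simp add: fam_def)
  moreover have "\<forall>YP. fam (fst YP) (snd YP) \<longrightarrow> card (fst YP) < Suc (card X)"
    using Suc.prems(1) by (auto simp: fam_def less_Suc_eq_le intro: card_mono)
  ultimately have "\<exists>YP. fam (fst YP) (snd YP) \<and>
      (\<forall>YP'. fam (fst YP') (snd YP') \<longrightarrow> card (fst YP') \<le> card (fst YP))"
    by (intro ex_has_greatest_nat[where b = "Suc (card X)" and k = "({}, \<lambda>_. [])"]) simp_all
  then obtain Y P where Y: "fam Y P" and max: "\<And>Y' P'. fam Y' P' \<Longrightarrow> card Y' \<le> card Y"
    by auto
  have finY: "finite Y" using Y Suc.prems(1) by (auto simp: fam_def intro: finite_subset)
  show ?case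
  proof (cases "K \<le> card Y")
    case True
    then obtain Y' where Y': "Y' \<subseteq> Y" "card Y' = K" by (meson obtain_subset_with_card_n)
    have "Y' \<subseteq> X" using Y Y'(1) by (auto simp: fam_def)
    moreover have "\<forall>y\<in>Y'. y \<noteq> v \<and> vpath_on E W (P y) \<and> hd (P y) = v \<and> last (P y) = y \<and> length (P y) \<le> Suc R"
      using Y Y'(1) Suc.prems(2) unfolding fam_def by (metis Suc_le_mono le_trans subsetD)
    moreover have "\<forall>y\<in>Y'. \<forall>y'\<in>Y'. y \<noteq> y' \<longrightarrow> set (P y) \<inter> set (P y') = {v}"
      using Y Y'(1) unfolding fam_def by (simp add: subset_iff)
    ultimately show ?thesis using Y'(2) unfolding path_star_def by blast
  next
    case False
    \<comment> \<open>\<open>v\<close> is left out: every path starts there, so it would block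
      trivially and nothing would get shorter.\<close>
    define Z where "Z = (\<Union>y\<in>Y. set (P y) - {v})"
    have "card (set (P y) - {v}) \<le> R" if "y \<in> Y" for y
    proof -
      have "vpath_on E W (P y)" "hd (P y) = v" "length (P y) \<le> Suc (Suc j)"
        using Y that by (auto simp: fam_def)
      then have "v \<in> set (P y)" "card (set (P y)) \<le> Suc (Suc j)"
        unfolding vpath_on_def by (metis hd_in_set, metis distinct_card)
      then show ?thesis using Suc.prems(2) by simp
    qed
    then have "(\<Sum>y\<in>Y. card (set (P y) - {v})) \<le> card Y * R"
      using sum_bounded_above[of Y "\<lambda>y. card (set (P y) - {v})" R] by simp
    also have "\<dots> \<le> K * R" using False by simp
    finally have "card Z \<le> K * R"
      unfolding Z_def using card_UN_le[OF finY, of "\<lambda>y. set (P y) - {v}"] by linarith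
    have finZ: "finite Z" using finY by (auto simp: Z_def)
    define N where "N z = {x \<in> X. \<exists>p. vpath_on E W p \<and> hd p = z \<and> last p = x \<and> length p \<le> Suc j}" for z
    have cover: "X - {v} \<subseteq> (\<Union>z\<in>Z. N z)"
    proof
      fix x assume x: "x \<in> X - {v}"
      show "x \<in> (\<Union>z\<in>Z. N z)"
      \<comment> \<open>Maximality says nothing about an end that the family already has; such an
        \<open>x\<close> lies in \<open>Z\<close> itself and is reached by the trivial path.\<close>
      proof (cases "x \<in> Y")
        case True
        then have "vpath_on E W (P x)" "last (P x) = x" using Y by (auto simp: fam_def)
        then have xP: "x \<in> set (P x)" and "x \<in> W" unfolding vpath_on_def by (metis last_in_set, metis last_in_set subsetD)
        then have "vpath_on E W [x]" by (simp add: vpath_on_def)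
        then have "x \<in> N x" using x unfolding N_def by (intro CollectI conjI exI[of _ "[x]"]) auto
        moreover have "x \<in> Z" using True xP x by (auto simp: Z_def)
        ultimately show ?thesis by blast
      next
        case False
        from Suc.prems(4)[of x] x obtain p where p: "vpath_on E W p" "hd p = v" "last p = x"
          "length p \<le> Suc (Suc j)" by auto
        have "set p \<inter> Z \<noteq> {}"
        proof
          assume empty: "set p \<inter> Z = {}"
          have vp: "v \<in> set p" using p by (metis hd_in_set vpath_on_def)
          have vP: "v \<in> set (P y)" if "y \<in> Y" for y
            using Y that unfolding fam_def vpath_on_def by (metis hd_in_set)
          have px: "set p \<inter> set (P y) = {v}" if "y \<in> Y" for y
            using empty vp vP[OF that] that by (auto simp: Z_def)
          have "fam (insert x Y) (P(x := p))"
            unfolding fam_def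
          proof (intro conjI ballI impI)
            show "insert x Y \<subseteq> X" using x Y by (auto simp: fam_def)
          next
            fix y assume "y \<in> insert x Y"
            with Y p x False show "y \<noteq> v" "vpath_on E W ((P(x := p)) y)" "hd ((P(x := p)) y) = v"
                "last ((P(x := p)) y) = y" "length ((P(x := p)) y) \<le> Suc (Suc j)"
              by (auto simp: fam_def)
          next
            fix y y' assume *: "y \<in> insert x Y" "y' \<in> insert x Y" "y \<noteq> y'"
            have "set (P y) \<inter> set (P y') = {v}" if "y \<in> Y" "y' \<in> Y"
              using Y that *(3) by (auto simp: fam_def)
            with * px False show "set ((P(x := p)) y) \<inter> set ((P(x := p)) y') = {v}"
              by (cases "y = x"; cases "y' = x") (auto simp: Int_commute)
          qed
          from max[OF this] False finY show False by simp
        qed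
        then obtain z where z: "z \<in> set p" "z \<in> Z" by blast
        then obtain a b where ab: "p = a @ z # b" by (meson split_list)
        \<comment> \<open>\<open>z\<close> differs from \<open>v\<close>, so the part of the path
          from \<open>z\<close> on has at least one edge less.\<close>
        have "a \<noteq> []" using z(2) ab p(2) by (auto simp: Z_def)
        then have "length (z # b) \<le> Suc j" using p(4) ab by (cases a) auto
        moreover have "vpath_on E W (z # b)" using p(1) ab by (auto intro: vpath_on_suffix)
        moreover have "last (z # b) = x" using p(3) ab by simp
        ultimately have "vpath_on E W (z # b) \<and> hd (z # b) = z \<and> last (z # b) = x \<and> length (z # b) \<le> Suc j"
          by simp
        then have "x \<in> N z" using x unfolding N_def by blast
        with z show ?thesis by blast
      qed
    qed
    have finN: "finite (N z)" for z using Suc.prems(1) by (simp add: N_def)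
    \<comment> \<open>Pigeonhole: otherwise \<open>X\<close> without \<open>v\<close> has at most
      \<open>K * R * ?M ^ j\<close> points. The summand 1 in \<open>?M\<close> pays for
      \<open>v\<close>.\<close>
    obtain z where z: "z \<in> Z" "?M ^ j < card (N z)"
    proof (rule ccontr)
      assume "\<not> thesis"
      with that have "card (N z) \<le> ?M ^ j" if "z \<in> Z" for z using \<open>z \<in> Z\<close> by (meson not_le)
      then have "(\<Sum>z\<in>Z. card (N z)) \<le> card Z * ?M ^ j"
        using sum_bounded_above[of Z "\<lambda>z. card (N z)" "?M ^ j"] by simp
      also have "\<dots> \<le> K * R * ?M ^ j" using \<open>card Z \<le> K * R\<close> by (rule mult_le_mono1)
      finally have "card (\<Union>z\<in>Z. N z) \<le> K * R * ?M ^ j"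
        using card_UN_le[OF finZ, of N] by linarith
      then have "card (X - {v}) \<le> K * R * ?M ^ j"
        using card_mono[OF _ cover] finZ finN by (meson finite_UN_I le_trans)
      then have "card X \<le> K * R * ?M ^ j + 1"
        using Suc.prems(1) by (simp add: card_Diff_singleton_if split: if_splits)
      also have "\<dots> \<le> K * R * ?M ^ j + ?M ^ j" by (simp add: Suc_le_eq)
      also have "\<dots> = ?M ^ Suc j" by (simp add: algebra_simps)
      finally show False using Suc.prems(3) by simp
    qed
    \<comment> \<open>\<open>R\<close> stays fixed while \<open>j\<close> drops, so the base
      \<open>?M\<close> is the same at every level.\<close>
    have "\<exists>u Y P. Y \<subseteq> N z \<and> card Y = K \<and> path_star E W R u Y P"
      by (rule Suc.IH[where v = z, OF finN _ z(2)]) (use Suc.prems(2) in \<open>auto simp: N_def\<close>)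
    moreover have "N z \<subseteq> X" by (auto simp: N_def)
    ultimately show ?thesis by blast
  qed
qed

text \<open>
  Here \<open>(2 * r + 3) * Suc k\<close> is the number of arms of the star: each arm meets at most \<open>r + 1\<close> of the
  trees, so \<open>Suc k\<close> of the arms meet only their own tree.
\<close>

definition family_bound :: "nat \<Rightarrow> nat \<Rightarrow> nat" where
  "family_bound r k = ((2 * r + 3) * Suc k * r + 1) ^ Suc r"

text \<open>The trees lack one level and have \<open>r\<close> children too many: the star supplies
  the top level, at the price of at most \<open>r\<close> branches at each root.\<close>

lemma disjoint_sdtrees_combine:
  assumes "finite X" "family_bound r k < card X"
    and tree: "\<And>x. x \<in> X \<Longrightarrow> sdtree E r (k + r) W d x (T x)"
    and disj: "\<And>x y. x \<in> X \<Longrightarrow> y \<in> X \<Longrightarrow> x \<noteq> y \<Longrightarrow> T x \<inter> T y = {}"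
    and ball: "\<And>x. x \<in> X \<Longrightarrow> \<exists>p. vpath_on E W p \<and> hd p = v \<and> last p = x \<and> length p \<le> Suc r"
  shows "\<exists>u A. sdtree E r k W (Suc d) u A"
proof -
  let ?K = "(2 * r + 3) * Suc k"
  \<comment> \<open>The star lemma asks for exponent \<open>r\<close>; \<open>family_bound\<close>
    has \<open>Suc r\<close>, the form that a bounded product over i <= r computes.\<close>
  have "(?K * r + 1) ^ r \<le> (?K * r + 1) ^ Suc r" by (intro power_increasing) auto
  then have "(?K * r + 1) ^ r < card X" using assms(2) unfolding family_bound_def by linarith
  from ball_contains_star[OF assms(1) order_refl this ball]
  obtain u Y P where Y: "Y \<subseteq> X" "card Y = ?K" and star: "path_star E W r u Y P"
    by blast
  have P: "y \<in> Y \<Longrightarrow> y \<noteq> u \<and> vpath_on E W (P y) \<and> hd (P y) = u \<and> last (P y) = y \<and> length (P y) \<le> Suc r" for y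
    using star by (auto simp: path_star_def)
  have Pdisj: "\<And>y y'. y \<in> Y \<Longrightarrow> y' \<in> Y \<Longrightarrow> y \<noteq> y' \<Longrightarrow> set (P y) \<inter> set (P y') = {u}"
    using star by (auto simp: path_star_def)
  have finY: "finite Y" using Y(1) assms(1) by (rule finite_subset)
  \<comment> \<open>The conflict digraph: \<open>y\<close> points to the trees that its arm meets,
    its own among them. Disjoint trees are met in distinct vertices, and the arm has at most
    \<open>r + 1\<close>.\<close>
  let ?f = "\<lambda>y. {y'. T y' \<inter> set (P y) \<noteq> {}}"
  have "card (?f y \<inter> Y) \<le> r + 1" if y: "y \<in> Y" for y
  proof -
    have "\<forall>y'\<in>?f y \<inter> Y. \<exists>z. z \<in> T y' \<inter> set (P y)" by blast
    then obtain h where h: "\<And>y'. y' \<in> ?f y \<inter> Y \<Longrightarrow> h y' \<in> T y' \<inter> set (P y)" by metis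
    have "inj_on h (?f y \<inter> Y)"
    proof (rule inj_onI, rule ccontr)
      fix a b assume ab: "a \<in> ?f y \<inter> Y" "b \<in> ?f y \<inter> Y" "h a = h b" "a \<noteq> b"
      then have "h a \<in> T a \<inter> T b" using h[OF ab(1)] h[OF ab(2)] by auto
      moreover have "T a \<inter> T b = {}" using ab Y(1) by (intro disj) auto
      ultimately show False by blast
    qed
    moreover have "h ` (?f y \<inter> Y) \<subseteq> set (P y)" using h by blast
    ultimately have "card (?f y \<inter> Y) \<le> card (set (P y))" by (intro card_inj_on_le) auto
    also have "\<dots> \<le> r + 1" using P[OF y] card_length[of "P y"] by linarith
    finally show ?thesis .
  qed
  from independent_subset[where f = ?f, OF finY this]
  obtain J where J: "J \<subseteq> Y" "card Y \<le> (2 * (r + 1) + 1) * card J"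
    and indep: "\<And>y y'. y \<in> J \<Longrightarrow> y' \<in> J \<Longrightarrow> y \<noteq> y' \<Longrightarrow> T y' \<inter> set (P y) = {}"
    by auto
  have "(2 * r + 3) * Suc k \<le> (2 * r + 3) * card J" using J(2) Y(2) by (simp add: algebra_simps)
  then have "Suc k \<le> card J" by (metis mult_le_cancel1 add_is_0 neq0_conv zero_neq_numeral)
  then obtain e where e: "inj_on e {..<Suc k}" "e ` {..<Suc k} \<subseteq> J"
    using card_le_inj[of "{..<Suc k}" J] J(1) finY finite_subset by auto
  have eJ: "e i \<in> J" and eY: "e i \<in> Y" and eX: "e i \<in> X" if "i < Suc k" for i
    using e(2) that J(1) Y(1) by auto
  have einj: "e i \<noteq> e j" if "i < Suc k" "j < Suc k" "i \<noteq> j" for i j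
    using e(1) that by (auto simp: inj_on_def)
  \<comment> \<open>One of the at most \<open>r + 1\<close> vertices of the arm is the root
    \<open>e i\<close>, so at most \<open>r\<close> have to be avoided.\<close>
  have "\<exists>B\<subseteq>T (e i). sdtree E r k W d (e i) B \<and> B \<inter> set (P (e i)) \<subseteq> {e i}" if "i < Suc k" for i
  proof (rule sdtree_prune[OF tree[OF eX[OF that]]])
    have "e i \<in> set (P (e i))" "card (set (P (e i))) \<le> Suc r"
      using P[OF eY[OF that]] card_length[of "P (e i)"] unfolding vpath_on_def
      by (metis last_in_set, linarith)
    then show "card (set (P (e i)) - {e i}) \<le> r" by simp
  qed simp
  then obtain B where B: "\<And>i. i < Suc k \<Longrightarrow> B i \<subseteq> T (e i) \<and> sdtree E r k W d (e i) (B i) \<and>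
      B i \<inter> set (P (e i)) \<subseteq> {e i}"
    by metis
  have ends: "u \<in> set (P (e i))" "e i \<in> set (P (e i))" if "i < Suc k" for i
    using P[OF eY[OF that]] unfolding vpath_on_def by (metis hd_in_set, metis last_in_set)
  have "sdtree E r k W (Suc d) u (insert u (\<Union>i<k. set ((P \<circ> e) i) \<union> B i))"
  proof (rule sdtree_SucI[OF _ _ _ refl])
    \<comment> \<open>Arm 0 exists even for \<open>k = 0\<close>; this is why \<open>Suc k\<close>
      arms were secured.\<close>
    show "u \<in> W" using ends(1)[of 0] P[OF eY[of 0]] unfolding vpath_on_def by auto
  next
    fix i assume "i < k"
    then have i: "i < Suc k" by simp
    have "set (P (e i)) \<inter> B i = {e i}" using B[OF i] ends[OF i] sdtree_root[of E r k W d "e i" "B i"] by blast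
    then show "vpath_on E W ((P \<circ> e) i) \<and> hd ((P \<circ> e) i) = u \<and> last ((P \<circ> e) i) = e i \<and> u \<noteq> e i \<and>
        length ((P \<circ> e) i) \<le> r + 2 \<and> sdtree E r k W d (e i) (B i) \<and> set ((P \<circ> e) i) \<inter> B i = {e i}"
      using P[OF eY[OF i]] B[OF i] by auto
  next
    fix i j assume "i < k" "j < k" and ij: "i \<noteq> j"
    then have i: "i < Suc k" and j: "j < Suc k" by simp_all
    note ne = einj[OF i j ij]
    have "set (P (e i)) \<inter> set (P (e j)) = {u}" using Pdisj[OF eY[OF i] eY[OF j] ne] .
    moreover have "T (e i) \<inter> T (e j) = {}" using disj[OF eX[OF i] eX[OF j] ne] .
    moreover have "T (e i) \<inter> set (P (e j)) = {}" "T (e j) \<inter> set (P (e i)) = {}"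
      using indep[OF eJ[OF j] eJ[OF i]] indep[OF eJ[OF i] eJ[OF j]] ne by auto
    ultimately show "(set ((P \<circ> e) i) \<union> B i) \<inter> (set ((P \<circ> e) j) \<union> B j) = {u}"
      using B[OF i] B[OF j] unfolding comp_def by blast
  qed
  then show ?thesis by blast
qed

text \<open>Splitter's move deletes a maximal family of disjoint trees in the ball.\<close>

lemma sdtree_hitting_set:
  fixes E :: "'a \<Rightarrow> 'a \<Rightarrow> bool" and v :: 'a
  assumes none: "\<not> (\<exists>u A. sdtree E r k W (Suc d) u A)"
  defines "B \<equiv> walk_ball E W r v"
  shows "\<exists>S\<subseteq>B. finite S \<and> card S \<le> family_bound r k * sdtree_size r (k + r) d \<and>
     \<not> (\<exists>u A. sdtree E r (k + r) (B - S) d u A)"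
proof -
  define fam where "fam X T \<longleftrightarrow> finite X \<and> (\<forall>x\<in>X. sdtree E r (k + r) B d x (T x)) \<and>
      (\<forall>x\<in>X. \<forall>y\<in>X. x \<noteq> y \<longrightarrow> T x \<inter> T y = {})" for X and T :: "'a \<Rightarrow> 'a set"
  have bound: "card X \<le> family_bound r k" if "fam X T" for X T
  proof (rule ccontr)
    assume "\<not> card X \<le> family_bound r k"
    moreover have "sdtree E r (k + r) W d x (T x)" if "x \<in> X" for x
      using \<open>fam X T\<close> that sdtree_subset[of E r "k + r" B d x "T x"] walk_ball_subset[of E W r v]
      unfolding fam_def B_def by (meson sdtree_change_set subset_trans)
    moreover have "\<exists>p. vpath_on E W p \<and> hd p = v \<and> last p = x \<and> length p \<le> Suc r" if "x \<in> X" for x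
    proof -
      have "x \<in> B" using \<open>fam X T\<close> that sdtree_root sdtree_subset unfolding fam_def by (meson subsetD)
      then show ?thesis unfolding B_def by (rule walk_ball_vpath_onE) blast
    qed
    ultimately show False
      using disjoint_sdtrees_combine[of X r k E W d T v] none \<open>fam X T\<close> unfolding fam_def by auto
  qed
  \<comment> \<open>A largest family exists by the bound on its size; \<open>W\<close> may be
    infinite.\<close>
  have "fam {} (\<lambda>_. {})" by (simp add: fam_def)
  moreover have "\<forall>XT. fam (fst XT) (snd XT) \<longrightarrow> card (fst XT) < Suc (family_bound r k)"
    using bound by (simp add: less_Suc_eq_le)
  ultimately have "\<exists>XT. fam (fst XT) (snd XT) \<and>
      (\<forall>XT'. fam (fst XT') (snd XT') \<longrightarrow> card (fst XT') \<le> card (fst XT))"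
    by (intro ex_has_greatest_nat[where b = "Suc (family_bound r k)" and k = "({}, \<lambda>_. {})"]) simp_all
  then obtain X T where X: "fam X T" and max: "\<And>X' T'. fam X' T' \<Longrightarrow> card X' \<le> card X"
    by auto
  define S where "S = (\<Union>x\<in>X. T x)"
  have finX: "finite X" using X by (simp add: fam_def)
  have tr: "sdtree E r (k + r) B d x (T x)" if "x \<in> X" for x using X that by (simp add: fam_def)
  have "S \<subseteq> B" unfolding S_def using sdtree_subset[OF tr] by blast
  moreover have "finite S" unfolding S_def using finX sdtree_finite[OF tr] by blast
  moreover have "card S \<le> family_bound r k * sdtree_size r (k + r) d"
  proof -
    have "card S \<le> (\<Sum>x\<in>X. card (T x))" unfolding S_def by (rule card_UN_le[OF finX])
    also have "\<dots> \<le> card X * sdtree_size r (k + r) d"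
      using sum_bounded_above[of X "\<lambda>x. card (T x)" "sdtree_size r (k + r) d"] card_sdtree[OF tr] by simp
    also have "\<dots> \<le> family_bound r k * sdtree_size r (k + r) d"
      using bound[OF X] by (rule mult_le_mono1)
    finally show ?thesis .
  qed
  moreover have "\<not> (\<exists>u A. sdtree E r (k + r) (B - S) d u A)"
  proof
    assume "\<exists>u A. sdtree E r (k + r) (B - S) d u A"
    then obtain u A where A: "sdtree E r (k + r) (B - S) d u A" by blast
    have sub: "A \<subseteq> B - S" using sdtree_subset[OF A] .
    \<comment> \<open>If \<open>u\<close> were a root of the family, it would lie in its own tree
      and thus in \<open>S\<close>.\<close>
    have uX: "u \<notin> X" using sub sdtree_root[OF A] sdtree_root[OF tr] unfolding S_def by blast
    have AB: "sdtree E r (k + r) B d u A" using A sub by (auto intro: sdtree_change_set)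
    have dj: "A \<inter> T x = {}" if "x \<in> X" for x using sub that unfolding S_def by blast
    have "fam (insert u X) (T(u := A))"
      unfolding fam_def
    proof (intro conjI ballI impI)
      show "finite (insert u X)" using finX by simp
    next
      fix x assume "x \<in> insert u X"
      then show "sdtree E r (k + r) B d x ((T(u := A)) x)" using AB tr uX by auto
    next
      fix x y assume *: "x \<in> insert u X" "y \<in> insert u X" "x \<noteq> y"
      have "T x \<inter> T y = {}" if "x \<in> X" "y \<in> X" using X that *(3) by (simp add: fam_def)
      with * dj uX show "(T(u := A)) x \<inter> (T(u := A)) y = {}"
        by (cases "x = u"; cases "y = u") (simp_all add: Int_commute)
    qed
    from max[OF this] uX finX show False by simp
  qed
  ultimately show ?thesis by blast
qed

section \<open>The game on vertex sets\<close>

text \<open>All positions of the game are induced subgraphs of the first one, so the vertex set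
  alone describes a position.\<close>

primrec wins_on :: "('a \<Rightarrow> 'a \<Rightarrow> bool) \<Rightarrow> nat \<Rightarrow> nat \<Rightarrow> nat \<Rightarrow> 'a set \<Rightarrow> bool" where
  "wins_on E m r 0 W \<longleftrightarrow> W = {}"
| "wins_on E m r (Suc n) W \<longleftrightarrow> (\<forall>v\<in>W. \<exists>S\<subseteq>walk_ball E W r v. finite S \<and> card S \<le> m \<and>
     wins_on E m r n (walk_ball E W r v - S))"

text \<open>One batch size has to serve all rounds. A sum over the rounds bounds each of them and
  stays within the operations shown to be elementary below.\<close>

primrec batch_bound :: "nat \<Rightarrow> nat \<Rightarrow> nat \<Rightarrow> nat" where
  "batch_bound r k 0 = 0"
| "batch_bound r k (Suc d) =
     family_bound r k * sdtree_size r (k + r) d + batch_bound r (k + r) d"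

text \<open>For \<open>d = 0\<close> the forbidden tree is a single vertex, so its absence means
  \<open>W = {}\<close>, the won position. Each round trades one level of depth for \<open>r\<close>
  more children.\<close>

lemma no_sdtree_imp_wins_on:
  assumes "\<not> (\<exists>u A. sdtree E r k W d u A)" "batch_bound r k d \<le> m"
  shows "wins_on E m r d W"
  using assms
proof (induction d arbitrary: k W)
  case 0
  then show ?case by auto
next
  case (Suc d)
  show ?case unfolding wins_on.simps
  proof
    fix v assume "v \<in> W"
    obtain S where S: "S \<subseteq> walk_ball E W r v" "finite S"
      "card S \<le> family_bound r k * sdtree_size r (k + r) d"
      "\<not> (\<exists>u A. sdtree E r (k + r) (walk_ball E W r v - S) d u A)"
      using sdtree_hitting_set[OF Suc.prems(1)] by blast
    then have "wins_on E m r d (walk_ball E W r v - S)"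
      using Suc.IH Suc.prems(2) by simp
    then show "\<exists>S\<subseteq>walk_ball E W r v. finite S \<and> card S \<le> m \<and> wins_on E m r d (walk_ball E W r v - S)"
      using S Suc.prems(2) by (intro exI[of _ S]) auto
  qed
qed

text \<open>Each level costs at most \<open>r + 1\<close> edges. A walk is enough for membership in
  \<open>walk_ball\<close>, so the pieces are concatenated without looking at disjointness.\<close>

lemma sdtree_radius:
  assumes "sdtree E r k W d v A" "u \<in> A"
  shows "\<exists>p. p \<noteq> [] \<and> set p \<subseteq> A \<and> successively E p \<and> hd p = v \<and> last p = u \<and> length p \<le> Suc (d * (r + 1))"
  using assms
proof (induction d arbitrary: v A)
  case 0
  then show ?case by (intro exI[of _ "[v]"]) simp
next
  case (Suc d)
  from Suc.prems(1) obtain w P B where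
     *: "\<And>i. i < k \<Longrightarrow> vpath_on E W (P i) \<and> hd (P i) = v \<and> last (P i) = w i \<and>
        length (P i) \<le> r + 2 \<and> sdtree E r k W d (w i) (B i)"
     and A: "A = insert v (\<Union>i<k. set (P i) \<union> B i)"
    by (elim sdtree_SucE) blast
  consider "u = v" | i where "i < k" "u \<in> set (P i)" | i where "i < k" "u \<in> B i"
    using A Suc.prems(2) by blast
  then show ?case
  proof cases
    case 1
    then show ?thesis using A by (intro exI[of _ "[v]"]) simp
  next
    case 2
    then obtain a b where ab: "P i = a @ u # b" by (meson split_list)
    have "hd (a @ [u]) = v" using *[OF 2(1)] ab by (cases a) simp_all
    moreover have "successively E (a @ [u])"
      using *[OF 2(1)] unfolding vpath_on_def ab by (simp add: successively_append_iff)
    moreover have "set (P i) \<subseteq> A" using A 2(1) by blast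
    then have "set (a @ [u]) \<subseteq> A" using ab by simp
    moreover have "length (a @ [u]) \<le> Suc (Suc d * (r + 1))" using *[OF 2(1)] ab by simp
    ultimately show ?thesis by (intro exI[of _ "a @ [u]"]) simp
  next
    case 3
    obtain p where p: "p \<noteq> []" "set p \<subseteq> B i" "successively E p" "hd p = w i" "last p = u"
        "length p \<le> Suc (d * (r + 1))"
      using Suc.IH[of "w i" "B i"] *[OF 3(1)] 3(2) by blast
    have Pi: "P i \<noteq> []" "successively E (P i)" using *[OF 3(1)] by (auto simp: vpath_on_def)
    obtain p' where p': "p = w i # p'" using p(1,4) by (cases p) auto
    have succ: "successively E (P i @ p')"
      using p(3) p' Pi * [OF 3(1)] by (auto simp: successively_append_iff successively_Cons)
    have last: "last (P i @ p') = u" using p(5) p' *[OF 3(1)] by (auto split: if_splits)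
    have "set (P i) \<subseteq> A" "B i \<subseteq> A" using A 3(1) by blast+
    moreover have "set p' \<subseteq> B i" using p(2) p' by simp
    ultimately have "set (P i @ p') \<subseteq> A" unfolding set_append by blast
    moreover have "length (P i @ p') \<le> Suc (Suc d * (r + 1))" using p(6) p' *[OF 3(1)] by simp
    moreover have "hd (P i @ p') = v" using Pi *[OF 3(1)] by simp
    ultimately show ?thesis using Pi(1) succ last by (intro exI[of _ "P i @ p'"]) simp
  qed
qed

text \<open>Localiser picks the root: the ball contains the tree, and some branch survives Splitter's move.\<close>

lemma sdtree_imp_not_wins_on:
  assumes "sdtree E r k W d v A" "m < k" "d * (r + 1) \<le> R"
  shows "\<not> wins_on E m R d W"
  using assms
proof (induction d arbitrary: W v A)
  case 0
  then show ?case by auto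
next
  case (Suc d)
  from Suc.prems(1) obtain w P B where vW: "v \<in> W" and
     *: "\<And>i. i < k \<Longrightarrow> v \<noteq> w i \<and> last (P i) = w i \<and> vpath_on E W (P i) \<and> hd (P i) = v \<and>
        sdtree E r k W d (w i) (B i) \<and> set (P i) \<inter> B i = {w i}" and
     disj: "\<And>i j. i < k \<Longrightarrow> j < k \<Longrightarrow> i \<noteq> j \<Longrightarrow> (set (P i) \<union> B i) \<inter> (set (P j) \<union> B j) = {v}" and
     A: "A = insert v (\<Union>i<k. set (P i) \<union> B i)"
    by (elim sdtree_SucE) blast
  \<comment> \<open>\<open>P i\<close> starts in \<open>v\<close> and meets \<open>B i\<close> only
    in \<open>w i\<close>, which differs from \<open>v\<close>.\<close>
  have vB: "v \<notin> B i" if "i < k" for i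
    using *[OF that] unfolding vpath_on_def by (metis IntI hd_in_set singletonD)
  have ball: "A \<subseteq> walk_ball E W R v"
  proof
    fix u assume "u \<in> A"
    from sdtree_radius[OF Suc.prems(1) this] obtain p where "p \<noteq> []" "set p \<subseteq> A" "successively E p"
      "hd p = v" "last p = u" "length p \<le> Suc (Suc d * (r + 1))" by blast
    then show "u \<in> walk_ball E W R v"
      using Suc.prems(3) sdtree_subset[OF Suc.prems(1)] unfolding walk_ball_def
      by (intro CollectI exI[of _ p]) auto
  qed
  have "\<not> wins_on E m R d (walk_ball E W R v - S)" if "finite S" "card S \<le> m" for S
  proof -
    have "\<exists>i<k. B i \<inter> S = {}"
    proof (rule ccontr)
      assume "\<not> (\<exists>i<k. B i \<inter> S = {})"
      then have "\<forall>i\<in>{..<k}. \<exists>x. x \<in> B i \<inter> S" by blast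
      then obtain h where h: "\<And>i. i < k \<Longrightarrow> h i \<in> B i \<inter> S" by (metis lessThan_iff)
      have "inj_on h {..<k}"
      proof (rule inj_onI, rule ccontr)
        fix i j assume ij: "i \<in> {..<k}" "j \<in> {..<k}" "h i = h j" "i \<noteq> j"
        then have "h i \<in> B i \<inter> B j" using h[of i] h[of j] by auto
        then show False using disj[of i j] vB[of i] ij by auto
      qed
      then have "k \<le> card S" using h that(1) card_inj_on_le[of h "{..<k}" S] by auto
      then show False using that(2) Suc.prems(2) by simp
    qed
    then obtain i where i: "i < k" "B i \<inter> S = {}" by blast
    \<comment> \<open>Splitter may have cut the path \<open>P i\<close>. Only the subtree below it
      goes into the next round, where Localiser plays \<open>w i\<close>.\<close>
    have "sdtree E r k (walk_ball E W R v - S) d (w i) (B i)"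
      using *[OF i(1)] by (elim conjE sdtree_change_set) (use i ball A in auto)
    then show ?thesis using Suc.IH Suc.prems(2,3) by simp
  qed
  then show ?case using vW unfolding wins_on.simps by blast
qed

section \<open>Topological minors of complete trees\<close>

lemma successively_iff_vwalk_arcs: "successively (dominates G) p \<longleftrightarrow> set (vwalk_arcs p) \<subseteq> arcs_ends G"
  by (induction p rule: vwalk_arcs.induct) auto

lemma vpath_iff_vpath_on: "vpath p G \<longleftrightarrow> vpath_on (dominates G) (verts G) p"
  by (auto simp: vpath_def vwalk_def vpath_on_def successively_iff_vwalk_arcs)

lemma dominates_induce_iff: "x \<rightarrow>\<^bsub>G \<restriction> W\<^esub> y \<longleftrightarrow> x \<rightarrow>\<^bsub>G\<^esub> y \<and> x \<in> W \<and> y \<in> W"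
  by (auto simp: arcs_ends_conv)

lemma successively_induce_iff:
  "set p \<subseteq> W \<Longrightarrow> successively (dominates (G \<restriction> W)) p \<longleftrightarrow> successively (dominates G) p"
  by (induction p rule: vwalk_arcs.induct) (auto simp: dominates_induce_iff)

lemma (in wf_digraph) awalk_cost_one: "awalk_cost (\<lambda>_. 1) p = real (length p)"
  by (induction p) auto

lemma (in wf_digraph) vwalk_imp_awalk:
  assumes "vwalk p G"
  shows "\<exists>q. awalk (hd p) q (last p) \<and> Suc (length q) = length p"
  using assms
proof (induction rule: vwalk_induct)
  case (Base u)
  then show ?case by (intro exI[of _ "[]"]) (simp add: awalk_Nil_iff)
next
  case (Cons u v es)
  then obtain q where q: "awalk v q (last (v # es))" "Suc (length q) = length (v # es)" by auto
  from Cons(1) obtain e where "e \<in> arcs G" "tail G e = u" "head G e = v" by auto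
  with q show ?case by (intro exI[of _ "e # q"]) (auto simp: awalk_Cons_iff)
qed

text \<open>The distance is an infimum of walk costs. These are natural numbers, so if no walk had
  cost at most \<open>r\<close>, the infimum would be at least \<open>r + 1\<close>.\<close>

lemma (in wf_digraph) mu_le_iff_vwalk:
  "\<mu> (\<lambda>_. 1) v u \<le> ereal (real r) \<longleftrightarrow>
     (\<exists>p. vwalk p G \<and> hd p = v \<and> last p = u \<and> length p \<le> Suc r)"
proof
  assume le: "\<mu> (\<lambda>_. 1) v u \<le> ereal (real r)"
  have "\<exists>q. awalk v q u \<and> length q \<le> r"
  proof (rule ccontr)
    assume "\<not> ?thesis"
    then have "real (Suc r) \<le> awalk_cost (\<lambda>_. 1) q" if "awalk v q u" for q
      using that by (simp add: awalk_cost_one not_le Suc_le_eq del: of_nat_Suc)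
    then have "ereal (real (Suc r)) \<le> \<mu> (\<lambda>_. 1) v u"
      unfolding \<mu>_def by (intro INF_greatest) (simp del: of_nat_Suc)
    with le have "ereal (real (Suc r)) \<le> ereal (real r)" by (rule order_trans[rotated])
    then show False by simp
  qed
  then obtain q where q: "awalk v q u" "length q \<le> r" by blast
  have "length (awalk_verts v q) = Suc (length q)" for v by (induction q arbitrary: v) auto
  with q have "vwalk (awalk_verts v q) G" "hd (awalk_verts v q) = v" "last (awalk_verts v q) = u"
    "length (awalk_verts v q) \<le> Suc r"
    using awalk_imp_vwalk by auto
  then show "\<exists>p. vwalk p G \<and> hd p = v \<and> last p = u \<and> length p \<le> Suc r" by blast
next
  assume "\<exists>p. vwalk p G \<and> hd p = v \<and> last p = u \<and> length p \<le> Suc r"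
  then obtain p where p: "vwalk p G" "hd p = v" "last p = u" "length p \<le> Suc r" by blast
  obtain q where q: "awalk v q u" "Suc (length q) = length p" using vwalk_imp_awalk[OF p(1)] p(2,3) by blast
  have "\<mu> (\<lambda>_. 1) v u \<le> ereal (awalk_cost (\<lambda>_. 1) q)" by (rule min_cost_le_walk_cost[OF q(1)])
  also have "\<dots> \<le> ereal (real r)" using q(2) p(4) by (simp add: awalk_cost_one)
  finally show "\<mu> (\<lambda>_. 1) v u \<le> ereal (real r)" .
qed

lemma gball_induce:
  assumes "wf_digraph G"
  shows "gball (G \<restriction> W) r v = walk_ball (dominates G) W r v"
proof -
  interpret H: wf_digraph "G \<restriction> W" using assms by (rule wf_digraph.wellformed_induce_subgraph)
  have "vwalk p (G \<restriction> W) \<longleftrightarrow> p \<noteq> [] \<and> set p \<subseteq> W \<and> successively (dominates G) p" for p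
    unfolding vwalk_def successively_iff_vwalk_arcs[symmetric] by (auto simp: successively_induce_iff)
  then show ?thesis
    unfolding gball_def walk_ball_def H.mu_le_iff_vwalk by (auto dest: last_in_set)
qed

lemma induce_induce: "B \<subseteq> W \<Longrightarrow> (G \<restriction> W) \<restriction> B = G \<restriction> B"
  by (auto simp: induce_subgraph_def)

lemma (in wf_digraph) induce_verts: "G \<restriction> verts G = G"
  by (rule pre_digraph.equality) auto

text \<open>Stated for every \<open>W\<close>, so that the induction hypothesis applies to the next
  position, where the nested restrictions collapse to a single one.\<close>

lemma splitter_wins_induce_iff:
  assumes "wf_digraph G"
  shows "splitter_wins m r n (G \<restriction> W) \<longleftrightarrow> wins_on (dominates G) m r n W"
proof (induction n arbitrary: W)
  case (Suc n)
  have "splitter_wins m r n (((G \<restriction> W) \<restriction> B) \<restriction> (B - S)) \<longleftrightarrow> wins_on (dominates G) m r n (B - S)"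
    if "B \<subseteq> W" for B S
    using that by (simp add: induce_induce Suc.IH)
  then show ?case
    using walk_ball_subset[of "dominates G" W r] by (simp add: Let_def gball_induce[OF assms])
qed simp

lemma splitter_wins_iff:
  assumes "wf_digraph G"
  shows "splitter_wins m r n G \<longleftrightarrow> wins_on (dominates G) m r n (verts G)"
  using splitter_wins_induce_iff[OF assms, of m r n "verts G"] wf_digraph.induce_verts[OF assms] by simp

section \<open>Complete trees as topological minors and as subdivided trees\<close>

definition tree_nodes :: "nat \<Rightarrow> nat \<Rightarrow> nat list set" where
  "tree_nodes d k = {xs. length xs \<le> d \<and> set xs \<subseteq> {..<k}}"

text \<open>\<open>complete_tree\<close> measures depth in vertices, \<open>tree_nodes\<close> and
  \<open>sdtree\<close> in edges; hence \<open>Suc d\<close> here and below.\<close>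

lemma verts_complete_tree: "verts (complete_tree (Suc d) k) = tree_nodes d k"
  by (simp add: complete_tree_def tree_nodes_def less_Suc_eq_le)

lemma dominates_complete_tree:
  "xs \<rightarrow>\<^bsub>complete_tree (Suc d) k\<^esub> ys \<longleftrightarrow>
     xs \<in> tree_nodes d k \<and> ys \<in> tree_nodes d k \<and> (\<exists>i. ys = i # xs \<or> xs = i # ys)"
  by (auto simp: complete_tree_def tree_nodes_def less_Suc_eq_le)

lemma path_decomp_inner:
  assumes "p \<noteq> []" "hd p \<noteq> last p"
  shows "p = hd p # inner_vertices p @ [last p]"
proof (cases p)
  case (Cons a q)
  with assms have "q \<noteq> []" by auto
  then show ?thesis using Cons by (simp add: inner_vertices_def)
qed (use assms in simp)

lemma inner_vertices_rev: "inner_vertices (rev p) = rev (inner_vertices p)"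
  unfolding inner_vertices_def
  by (metis butlast_rev butlast_tl rev_rev_ident)

text \<open>The subdivided tree is assembled from the leaves upwards. Every piece consists of images
  of nodes and interiors of edges, so all intersections can be computed with lists.\<close>

lemma stm_complete_tree_imp_sdtree:
  assumes "shallow_topological_minor r (complete_tree (Suc d) k) G"
  shows "\<exists>u A. sdtree (dominates G) r k (verts G) d u A"
proof -
  let ?H = "complete_tree (Suc d) k"
  let ?V = "tree_nodes d k"
  from assms obtain \<phi> P where inj: "inj_on \<phi> ?V" and img: "\<phi> ` ?V \<subseteq> verts G"
    and path: "\<And>u v. u \<rightarrow>\<^bsub>?H\<^esub> v \<Longrightarrow> vpath (P u v) G \<and> hd (P u v) = \<phi> u \<and> last (P u v) = \<phi> v \<and>
        length (inner_vertices (P u v)) \<le> r \<and> set (inner_vertices (P u v)) \<inter> \<phi> ` ?V = {}"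
    and disj: "\<And>u v x y. u \<rightarrow>\<^bsub>?H\<^esub> v \<Longrightarrow> x \<rightarrow>\<^bsub>?H\<^esub> y \<Longrightarrow> {u, v} \<noteq> {x, y} \<Longrightarrow>
        set (inner_vertices (P u v)) \<inter> set (inner_vertices (P x y)) = {}"
    unfolding shallow_topological_minor_def verts_complete_tree by metis
  \<comment> \<open>Edges are named by their lower end \<open>c\<close>, the longer of the two
    lists.\<close>
  define I where "I c = set (inner_vertices (P (tl c) c))" for c
  have edge: "tl c \<rightarrow>\<^bsub>?H\<^esub> c" if "c \<in> ?V" "c \<noteq> []" for c
    using that unfolding dominates_complete_tree by (cases c) (auto simp: tree_nodes_def)
  have I1: "I c \<inter> \<phi> ` ?V = {}" if "c \<in> ?V - {[]}" for c
    using path[OF edge] that unfolding I_def by auto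
  have I2: "I c \<inter> I c' = {}" if "c \<in> ?V - {[]}" "c' \<in> ?V - {[]}" "c \<noteq> c'" for c c'
  proof -
    have "{tl c, c} \<noteq> {tl c', c'}"
      using that by (cases c; cases c') (auto simp: doubleton_eq_iff dest: arg_cong[where f = length])
    then show ?thesis using disj[OF edge edge] that unfolding I_def by auto
  qed
  \<comment> \<open>\<open>U D S\<close> is the part of \<open>G\<close> occupied by the nodes
    \<open>D\<close> and the interiors of the edges \<open>S\<close>. By \<open>U_Int\<close> it
    commutes with intersection.\<close>
  define U where "U D S = \<phi> ` D \<union> (\<Union>c\<in>S. I c)" for D S
  have U_Int: "U D S \<inter> U D' S' = U (D \<inter> D') (S \<inter> S')"
    if "D \<subseteq> ?V" "D' \<subseteq> ?V" "S \<subseteq> ?V - {[]}" "S' \<subseteq> ?V - {[]}" for D D' S S'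
  proof
    show "U D S \<inter> U D' S' \<subseteq> U (D \<inter> D') (S \<inter> S')"
    proof
      fix x assume "x \<in> U D S \<inter> U D' S'"
      then consider a b where "a \<in> D" "b \<in> D'" "x = \<phi> a" "x = \<phi> b"
        | a c where "a \<in> D \<union> D'" "c \<in> S \<union> S'" "x = \<phi> a" "x \<in> I c"
        | c c' where "c \<in> S" "c' \<in> S'" "x \<in> I c" "x \<in> I c'"
        unfolding U_def by blast
      then show "x \<in> U (D \<inter> D') (S \<inter> S')"
      proof cases
        case 1
        then have "a = b" using inj that by (meson inj_onD subsetD)
        with 1 show ?thesis by (auto simp: U_def)
      next
        case 2
        then show ?thesis using I1[of c] that by blast
      next
        case 3
        then have "c = c'" using I2[of c c'] that by blast
        with 3 show ?thesis by (auto simp: U_def)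
      qed
    qed
  qed (auto simp: U_def)
  have U_mono: "U D S \<subseteq> U D' S'" if "D \<subseteq> D'" "S \<subseteq> S'" for D D' S S'
    using that by (auto simp: U_def)
  \<comment> \<open>Nodes are reversed, so the descendants of \<open>xs\<close> are the lists that
    end in \<open>xs\<close>. Below, \<open>xs\<close> is removed from the edge set, as the edge
    named \<open>xs\<close> leads upwards.\<close>
  define Desc where "Desc xs = {ys \<in> ?V. \<exists>zs. ys = zs @ xs}" for xs
  have "\<exists>A\<subseteq>U (Desc xs) (Desc xs - {xs}). sdtree (dominates G) r k (verts G) e (\<phi> xs) A"
    if "xs \<in> ?V" "length xs + e = d" for xs e
    using that
  proof (induction e arbitrary: xs)
    case 0
    then show ?case using img by (intro exI[of _ "{\<phi> xs}"]) (auto simp: U_def Desc_def)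
  next
    case (Suc e)
    have ch: "i # xs \<in> ?V" if "i < k" for i using Suc.prems that by (simp add: tree_nodes_def)
    have "\<exists>A\<subseteq>U (Desc (i # xs)) (Desc (i # xs) - {i # xs}).
        sdtree (dominates G) r k (verts G) e (\<phi> (i # xs)) A" if "i < k" for i
      using Suc.IH[OF ch[OF that]] Suc.prems(2) by simp
    then obtain B where B: "\<And>i. i < k \<Longrightarrow> B i \<subseteq> U (Desc (i # xs)) (Desc (i # xs) - {i # xs})"
      "\<And>i. i < k \<Longrightarrow> sdtree (dominates G) r k (verts G) e (\<phi> (i # xs)) (B i)"
      by metis
    let ?P = "\<lambda>i. P xs (i # xs)"
    have P: "vpath_on (dominates G) (verts G) (?P i)" "hd (?P i) = \<phi> xs" "last (?P i) = \<phi> (i # xs)"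
        "\<phi> xs \<noteq> \<phi> (i # xs)" "length (?P i) \<le> r + 2" "set (?P i) = U {xs, i # xs} {i # xs}" if "i < k" for i
    proof -
      note p = path[OF edge[OF ch[OF that]], simplified]
      show v: "vpath_on (dominates G) (verts G) (?P i)" and h: "hd (?P i) = \<phi> xs"
        and l: "last (?P i) = \<phi> (i # xs)"
        using p by (auto simp: vpath_iff_vpath_on)
      show ne: "\<phi> xs \<noteq> \<phi> (i # xs)"
        using inj Suc.prems(1) ch[OF that] by (metis inj_onD not_Cons_self)
      have eq: "?P i = \<phi> xs # inner_vertices (?P i) @ [\<phi> (i # xs)]"
        using path_decomp_inner[of "?P i"] v h l ne by (simp add: vpath_on_def)
      then have "length (?P i) = length (inner_vertices (?P i)) + 2"
        by (metis length_Cons length_append_singleton add_2_eq_Suc')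
      then show "length (?P i) \<le> r + 2" using p by simp
      have "set (?P i) = {\<phi> xs, \<phi> (i # xs)} \<union> set (inner_vertices (?P i))"
        by (subst eq) auto
      then show "set (?P i) = U {xs, i # xs} {i # xs}" by (simp add: U_def I_def)
    qed
    have sub: "Desc ys \<subseteq> ?V" for ys by (auto simp: Desc_def)
    have nonroot: "Desc (i # xs) \<subseteq> ?V - {[]}" for i by (auto simp: Desc_def)
    have xsD: "xs \<notin> Desc (i # xs)" for i by (auto simp: Desc_def)
    have self: "i # xs \<in> Desc (i # xs)" if "i < k" for i using ch[OF that] by (auto simp: Desc_def)
    have DD: "Desc (i # xs) \<inter> Desc (j # xs) = {}" if "i \<noteq> j" for i j
      using that by (auto simp: Desc_def append_eq_append_conv2 append_eq_Cons_conv)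
    have "sdtree (dominates G) r k (verts G) (Suc e) (\<phi> xs) (insert (\<phi> xs) (\<Union>i<k. set (?P i) \<union> B i))"
    proof (rule sdtree_SucI[OF _ _ _ refl])
      show "\<phi> xs \<in> verts G" using img Suc.prems(1) by blast
    next
      fix i assume i: "i < k"
      have "set (?P i) \<inter> B i \<subseteq> U {xs, i # xs} {i # xs} \<inter> U (Desc (i # xs)) (Desc (i # xs) - {i # xs})"
        using P(6)[OF i] B(1)[OF i] by blast
      also have "\<dots> = U ({xs, i # xs} \<inter> Desc (i # xs)) ({i # xs} \<inter> (Desc (i # xs) - {i # xs}))"
        using Suc.prems(1) ch[OF i] sub nonroot by (intro U_Int) auto
      also have "\<dots> \<subseteq> {\<phi> (i # xs)}" using xsD by (auto simp: U_def)
      finally have "set (?P i) \<inter> B i = {\<phi> (i # xs)}"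
        using sdtree_root[OF B(2)[OF i]] P(6)[OF i] by (auto simp: U_def)
      then show "vpath_on (dominates G) (verts G) (?P i) \<and> hd (?P i) = \<phi> xs \<and> last (?P i) = \<phi> (i # xs) \<and>
         \<phi> xs \<noteq> \<phi> (i # xs) \<and> length (?P i) \<le> r + 2 \<and>
         sdtree (dominates G) r k (verts G) e (\<phi> (i # xs)) (B i) \<and> set (?P i) \<inter> B i = {\<phi> (i # xs)}"
        using P[OF i] B(2)[OF i] by simp
    next
      fix i j assume i: "i < k" and j: "j < k" and ij: "i \<noteq> j"
      have PB: "set (?P i) \<union> B i \<subseteq> U (insert xs (Desc (i # xs))) (Desc (i # xs))" if "i < k" for i
        using P(6)[OF that] B(1)[OF that] self[OF that] by (auto simp: U_def)
      have "(set (?P i) \<union> B i) \<inter> (set (?P j) \<union> B j) \<subseteq>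
          U (insert xs (Desc (i # xs))) (Desc (i # xs)) \<inter> U (insert xs (Desc (j # xs))) (Desc (j # xs))"
        using PB[OF i] PB[OF j] by blast
      also have "\<dots> = U (insert xs (Desc (i # xs)) \<inter> insert xs (Desc (j # xs))) (Desc (i # xs) \<inter> Desc (j # xs))"
        using Suc.prems(1) sub nonroot by (intro U_Int) auto
      also have "\<dots> = {\<phi> xs}" using DD[OF ij] xsD by (auto simp: U_def)
      finally show "(set (?P i) \<union> B i) \<inter> (set (?P j) \<union> B j) = {\<phi> xs}"
        using P(6)[OF i] P(6)[OF j] by (auto simp: U_def)
    qed
    moreover have "insert (\<phi> xs) (\<Union>i<k. set (?P i) \<union> B i) \<subseteq> U (Desc xs) (Desc xs - {xs})"
    proof -
      have xs: "xs \<in> Desc xs" using Suc.prems(1) by (auto simp: Desc_def)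
      have sub': "Desc (i # xs) \<subseteq> Desc xs - {xs}" for i by (auto simp: Desc_def)
      have "set (?P i) \<union> B i \<subseteq> U (Desc xs) (Desc xs - {xs})" if "i < k" for i
      proof -
        have "set (?P i) \<union> B i \<subseteq> U (insert xs (Desc (i # xs))) (Desc (i # xs))"
          using P(6)[OF that] B(1)[OF that] self[OF that] by (auto simp: U_def)
        also have "\<dots> \<subseteq> U (Desc xs) (Desc xs - {xs})"
          using sub'[of i] xs by (intro U_mono) auto
        finally show ?thesis .
      qed
      moreover have "\<phi> xs \<in> U (Desc xs) (Desc xs - {xs})" using xs by (simp add: U_def)
      ultimately show ?thesis by (intro insert_subsetI UN_least) auto
    qed
    ultimately show ?case by blast
  qed
  from this[of "[]" d] show ?thesis by (auto simp: tree_nodes_def)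
qed

text \<open>\<open>Q c\<close> is the path replacing the edge between the node \<open>c \<noteq> []\<close> and its parent \<open>tl c\<close>.\<close>

definition tree_embedding ::
  "('a \<Rightarrow> 'a \<Rightarrow> bool) \<Rightarrow> nat \<Rightarrow> nat \<Rightarrow> 'a set \<Rightarrow> nat \<Rightarrow> 'a set \<Rightarrow> (nat list \<Rightarrow> 'a) \<Rightarrow> (nat list \<Rightarrow> 'a list) \<Rightarrow> bool"
  where
  "tree_embedding E r k W d A \<phi> Q \<longleftrightarrow>
     inj_on \<phi> (tree_nodes d k) \<and> \<phi> ` tree_nodes d k \<subseteq> A \<and>
     (\<forall>c\<in>tree_nodes d k - {[]}. vpath_on E W (Q c) \<and> hd (Q c) = \<phi> (tl c) \<and> last (Q c) = \<phi> c \<and>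
        length (Q c) \<le> r + 2 \<and> set (Q c) \<subseteq> A \<and> set (inner_vertices (Q c)) \<inter> \<phi> ` tree_nodes d k = {}) \<and>
     (\<forall>c\<in>tree_nodes d k - {[]}. \<forall>c'\<in>tree_nodes d k - {[]}. c \<noteq> c' \<longrightarrow>
        set (inner_vertices (Q c)) \<inter> set (inner_vertices (Q c')) = {})"

lemma tree_embeddingD:
  assumes "tree_embedding E r k W d A \<phi> Q"
  shows "inj_on \<phi> (tree_nodes d k)" "\<And>c. c \<in> tree_nodes d k \<Longrightarrow> \<phi> c \<in> A"
    "\<And>c. c \<in> tree_nodes d k \<Longrightarrow> c \<noteq> [] \<Longrightarrow> vpath_on E W (Q c) \<and> hd (Q c) = \<phi> (tl c) \<and> last (Q c) = \<phi> c \<and>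
        length (Q c) \<le> r + 2 \<and> set (Q c) \<subseteq> A"
    "\<And>c x. c \<in> tree_nodes d k \<Longrightarrow> c \<noteq> [] \<Longrightarrow> x \<in> tree_nodes d k \<Longrightarrow> \<phi> x \<notin> set (inner_vertices (Q c))"
    "\<And>c c'. c \<in> tree_nodes d k \<Longrightarrow> c \<noteq> [] \<Longrightarrow> c' \<in> tree_nodes d k \<Longrightarrow> c' \<noteq> [] \<Longrightarrow> c \<noteq> c' \<Longrightarrow>
       set (inner_vertices (Q c)) \<inter> set (inner_vertices (Q c')) = {}"
  using assms unfolding tree_embedding_def by (simp_all, blast+)

lemma set_inner_vertices_subset: "set (inner_vertices p) \<subseteq> set p"
  unfolding inner_vertices_def by (metis in_set_butlastD list.set_sel(2) subsetI tl_Nil)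

lemma inner_vertices_ends:
  assumes "distinct p" "p \<noteq> []"
  shows "hd p \<notin> set (inner_vertices p)" "last p \<notin> set (inner_vertices p)"
proof -
  show "hd p \<notin> set (inner_vertices p)"
    using assms by (cases p) (auto simp: inner_vertices_def dest: in_set_butlastD)
  show "last p \<notin> set (inner_vertices p)"
  proof (cases "tl p = []")
    case False
    then have "last p = last (tl p)" "distinct (tl p)" using assms by (auto simp: last_tl distinct_tl)
    then show ?thesis
      unfolding inner_vertices_def using False
      by (metis append_butlast_last_id disjoint_insert(2) distinct_append list.simps(15) Int_commute)
  qed (simp add: inner_vertices_def)
qed

text \<open>In a reversed list the last entry is the first step from the root:
  \<open>xs @ [i]\<close> is the node \<open>xs\<close> of the branch number
  \<open>i\<close>.\<close>

lemma tree_nodes_snoc: "xs @ [i] \<in> tree_nodes (Suc d) k \<longleftrightarrow> xs \<in> tree_nodes d k \<and> i < k"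
  by (auto simp: tree_nodes_def)

lemma Nil_in_tree_nodes: "[] \<in> tree_nodes d k"
  by (simp add: tree_nodes_def)

text \<open>Embeddings of the branches are glued at the root. Removing the head of a list gives the
  parent and removing the last entry gives the position inside the branch; the two commute below the
  top level.\<close>

lemma sdtree_imp_tree_embedding:
  assumes "sdtree E r k W d v A"
  shows "\<exists>\<phi> Q. tree_embedding E r k W d A \<phi> Q \<and> \<phi> [] = v"
  using assms
proof (induction d arbitrary: v A)
  case 0
  have "tree_nodes 0 k = {[]}" by (auto simp: tree_nodes_def)
  with 0 show ?case by (intro exI[of _ "\<lambda>_. v"]) (simp add: tree_embedding_def)
next
  case (Suc d)
  from Suc.prems obtain w P B where vW: "v \<in> W"
    and P: "\<And>i. i < k \<Longrightarrow> vpath_on E W (P i) \<and> hd (P i) = v \<and> last (P i) = w i \<and> v \<noteq> w i \<and>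
        length (P i) \<le> r + 2 \<and> sdtree E r k W d (w i) (B i) \<and> set (P i) \<inter> B i = {w i}"
    and disj: "\<And>i j. i < k \<Longrightarrow> j < k \<Longrightarrow> i \<noteq> j \<Longrightarrow> (set (P i) \<union> B i) \<inter> (set (P j) \<union> B j) = {v}"
    and A: "A = insert v (\<Union>i<k. set (P i) \<union> B i)"
    by (elim sdtree_SucE) blast
  have "\<forall>i\<in>{..<k}. \<exists>\<phi>Q. tree_embedding E r k W d (B i) (fst \<phi>Q) (snd \<phi>Q) \<and> fst \<phi>Q [] = w i"
    using Suc.IH P by simp
  then obtain f where f: "\<And>i. i < k \<Longrightarrow> tree_embedding E r k W d (B i) (fst (f i)) (snd (f i))"
    "\<And>i. i < k \<Longrightarrow> fst (f i) [] = w i"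
    by (metis lessThan_iff)
  define F where "F i = fst (f i)" for i
  define Q' where "Q' i = snd (f i)" for i
  have emb: "tree_embedding E r k W d (B i) (F i) (Q' i)" and root: "F i [] = w i" if "i < k" for i
    using f that by (auto simp: F_def Q'_def)
  note embD = tree_embeddingD[OF emb]
  have vB: "v \<notin> B i" if "i < k" for i
    using P[OF that] unfolding vpath_on_def by (metis IntI hd_in_set singletonD)
  have BB: "B i \<inter> B j = {}" if "i < k" "j < k" "i \<noteq> j" for i j
    using disj[OF that] vB[OF that(1)] by auto
  \<comment> \<open>\<open>v\<close>, the interiors \<open>J i\<close> and the subtrees
    \<open>B i\<close> are pairwise disjoint. The next facts establish this, and injectivity and
    disjointness are read off from it.\<close>
  define J where "J i = set (inner_vertices (P i))" for i
  have JP: "J i \<subseteq> set (P i)" and Jv: "v \<notin> J i" and Jw: "w i \<notin> J i" if "i < k" for i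
    using P[OF that] inner_vertices_ends[of "P i"] set_inner_vertices_subset[of "P i"]
    unfolding J_def vpath_on_def by auto
  have disj': "(set (P i) \<union> B i) \<inter> (set (P j) \<union> B j) \<subseteq> {v}" if "i < k" "j < k" "i \<noteq> j" for i j
    using disj[OF that] by (rule equalityD1)
  have JB: "J i \<inter> B j = {}" if "i < k" "j < k" for i j
  proof (cases "i = j")
    case True
    have "J i \<inter> B i \<subseteq> set (P i) \<inter> B i" using JP[OF that(1)] by (intro Int_mono) auto
    also have "\<dots> = {w i}" using P[OF that(1)] by simp
    finally show ?thesis using Jw[OF that(1)] True by blast
  next
    case False
    have "J i \<inter> B j \<subseteq> (set (P i) \<union> B i) \<inter> (set (P j) \<union> B j)"
      using JP[OF that(1)] by (intro Int_mono) auto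
    also have "\<dots> \<subseteq> {v}" using disj'[OF that False] .
    finally show ?thesis using Jv[OF that(1)] by blast
  qed
  have JJ: "J i \<inter> J j = {}" if "i < k" "j < k" "i \<noteq> j" for i j
  proof -
    have "J i \<inter> J j \<subseteq> (set (P i) \<union> B i) \<inter> (set (P j) \<union> B j)"
      using JP[OF that(1)] JP[OF that(2)] by (intro Int_mono) auto
    also have "\<dots> \<subseteq> {v}" using disj'[OF that] .
    finally show ?thesis using Jv[OF that(1)] by blast
  qed
  have QB: "set (inner_vertices (Q' i c)) \<subseteq> B i" if "i < k" "c \<in> tree_nodes d k" "c \<noteq> []" for i c
    using embD(3)[OF that] set_inner_vertices_subset[of "Q' i c"] by blast
  \<comment> \<open>The last entry selects the branch. A node \<open>[i]\<close> hangs on the new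
    path \<open>P i\<close>; deeper nodes keep the path of their branch.\<close>
  define \<phi> where "\<phi> xs = (if xs = [] then v else F (last xs) (butlast xs))" for xs
  define Q where "Q xs = (if butlast xs = [] then P (last xs) else Q' (last xs) (butlast xs))" for xs
  have \<phi>_simps: "\<phi> [] = v" "\<phi> (xs @ [i]) = F i xs" for xs i by (simp_all add: \<phi>_def)
  have Q_simps: "Q [i] = P i" "xs \<noteq> [] \<Longrightarrow> Q (xs @ [i]) = Q' i xs" for xs i by (simp_all add: Q_def)
  let ?V = "tree_nodes (Suc d) k"
  have node_cases: thesis
    if "c \<in> ?V" "c = [] \<Longrightarrow> thesis" "\<And>xs i. c = xs @ [i] \<Longrightarrow> xs \<in> tree_nodes d k \<Longrightarrow> i < k \<Longrightarrow> thesis"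
    for c thesis
    using that by (cases c rule: rev_cases) (auto simp: tree_nodes_snoc)
  have edge_cases: thesis
    if "c \<in> ?V" "c \<noteq> []" "\<And>i. c = [i] \<Longrightarrow> i < k \<Longrightarrow> thesis"
      "\<And>xs i. c = xs @ [i] \<Longrightarrow> xs \<noteq> [] \<Longrightarrow> xs \<in> tree_nodes d k \<Longrightarrow> i < k \<Longrightarrow> thesis"
    for c thesis
    using that by (cases c rule: rev_cases) (auto simp: tree_nodes_snoc)
  have inj: "inj_on \<phi> ?V"
  proof (rule inj_onI)
    fix c c' assume c: "c \<in> ?V" and c': "c' \<in> ?V" and eq: "\<phi> c = \<phi> c'"
    show "c = c'"
    proof (rule node_cases[OF c]; rule node_cases[OF c'])
      fix xs i assume *: "c = []" "c' = xs @ [i]" "xs \<in> tree_nodes d k" "i < k"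
      then show ?thesis using eq vB[of i] embD(2)[of i xs] by (auto simp: \<phi>_simps)
    next
      fix xs i assume *: "c' = []" "c = xs @ [i]" "xs \<in> tree_nodes d k" "i < k"
      then show ?thesis using eq vB[of i] embD(2)[of i xs] by (auto simp: \<phi>_simps)
    next
      fix xs i ys j assume *: "c = xs @ [i]" "c' = ys @ [j]" "xs \<in> tree_nodes d k" "i < k"
        "ys \<in> tree_nodes d k" "j < k"
      then have e: "F i xs = F j ys" using eq by (simp add: \<phi>_simps)
      then have "i = j" using * BB[of i j] embD(2)[of i xs] embD(2)[of j ys] by (metis IntI empty_iff)
      with e * show ?thesis using embD(1)[of i] by (auto dest: inj_onD)
    qed simp
  qed
  have BA: "B i \<subseteq> A" and PA: "set (P i) \<subseteq> A" if "i < k" for i using A that by auto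
  have img: "\<phi> c \<in> A" if "c \<in> ?V" for c
  proof (rule node_cases[OF that])
    assume "c = []"
    then show ?thesis using A by (simp add: \<phi>_simps)
  next
    fix xs i assume "c = xs @ [i]" "xs \<in> tree_nodes d k" "i < k"
    then show ?thesis using BA[of i] embD(2)[of i xs] by (simp add: \<phi>_simps subset_iff)
  qed
  have path: "vpath_on E W (Q c) \<and> hd (Q c) = \<phi> (tl c) \<and> last (Q c) = \<phi> c \<and>
        length (Q c) \<le> r + 2 \<and> set (Q c) \<subseteq> A" if "c \<in> ?V" "c \<noteq> []" for c
  proof (rule edge_cases[OF that])
    fix i assume i: "c = [i]" "i < k"
    then have "\<phi> (tl c) = v" "\<phi> c = w i" using \<phi>_simps(2)[of "[]" i] root by (auto simp: \<phi>_simps)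
    then show ?thesis using P[OF i(2)] PA[OF i(2)] i(1) Q_simps by auto
  next
    fix xs i assume *: "c = xs @ [i]" "xs \<noteq> []" "xs \<in> tree_nodes d k" "i < k"
    then have "\<phi> (tl c) = F i (tl xs)" "\<phi> c = F i xs" "Q c = Q' i xs" by (auto simp: \<phi>_simps Q_simps)
    then show ?thesis using embD(3)[OF *(4,3,2)] BA[OF *(4)] by auto
  qed
  have inner: "\<phi> x \<notin> set (inner_vertices (Q c))" if "c \<in> ?V" "c \<noteq> []" "x \<in> ?V" for c x
  proof (rule edge_cases[OF that(1,2)]; rule node_cases[OF that(3)])
    fix i assume "c = [i]" "i < k" "x = []"
    then show ?thesis using Jv by (simp add: \<phi>_simps Q_simps J_def)
  next
    fix i ys j assume "c = [i]" "i < k" "x = ys @ [j]" "ys \<in> tree_nodes d k" "j < k"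
    then show ?thesis using JB[of i j] embD(2)[of j ys] by (auto simp: \<phi>_simps Q_simps J_def)
  next
    fix xs i assume "c = xs @ [i]" "xs \<noteq> []" "xs \<in> tree_nodes d k" "i < k" "x = []"
    then show ?thesis using QB[of i xs] vB[of i] by (auto simp: \<phi>_simps Q_simps)
  next
    fix xs i ys j assume *: "c = xs @ [i]" "xs \<noteq> []" "xs \<in> tree_nodes d k" "i < k"
      "x = ys @ [j]" "ys \<in> tree_nodes d k" "j < k"
    show ?thesis
    proof (cases "i = j")
      case True
      then show ?thesis using * embD(4)[of i xs ys] by (simp add: \<phi>_simps Q_simps)
    next
      case False
      then show ?thesis using * QB[of i xs] BB[of i j] embD(2)[of j ys] by (auto simp: \<phi>_simps Q_simps)
    qed
  qed
  have disjoint: "set (inner_vertices (Q c)) \<inter> set (inner_vertices (Q c')) = {}"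
    if "c \<in> ?V" "c \<noteq> []" "c' \<in> ?V" "c' \<noteq> []" "c \<noteq> c'" for c c'
  proof (rule edge_cases[OF that(1,2)]; rule edge_cases[OF that(3,4)])
    fix i j assume "c = [i]" "i < k" "c' = [j]" "j < k"
    then show ?thesis using JJ[of i j] that(5) by (auto simp: Q_simps J_def)
  next
    fix i ys j assume "c = [i]" "i < k" "c' = ys @ [j]" "ys \<noteq> []" "ys \<in> tree_nodes d k" "j < k"
    then show ?thesis using JB[of i j] QB[of j ys] by (auto simp: Q_simps J_def)
  next
    fix i ys j assume "c' = [i]" "i < k" "c = ys @ [j]" "ys \<noteq> []" "ys \<in> tree_nodes d k" "j < k"
    then show ?thesis using JB[of i j] QB[of j ys] by (auto simp: Q_simps J_def)
  next
    fix xs i ys j assume *: "c = xs @ [i]" "xs \<noteq> []" "xs \<in> tree_nodes d k" "i < k"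
      "c' = ys @ [j]" "ys \<noteq> []" "ys \<in> tree_nodes d k" "j < k"
    show ?thesis
    proof (cases "i = j")
      case True
      then show ?thesis using * that(5) embD(5)[of i xs ys] by (simp add: Q_simps)
    next
      case False
      have "Q c = Q' i xs" "Q c' = Q' j ys" using * by (simp_all add: Q_simps)
      then show ?thesis using * QB[of i xs] QB[of j ys] BB[of i j] False by auto
    qed
  qed
  have "tree_embedding E r k W (Suc d) A \<phi> Q"
    unfolding tree_embedding_def using inj img path inner disjoint by auto
  then show ?case using \<phi>_simps(1) by blast
qed

lemma tree_embedding_imp_stm:
  assumes sym: "symmetric G" and emb: "tree_embedding (dominates G) r k (verts G) d A \<phi> Q" and A: "A \<subseteq> verts G"
  shows "shallow_topological_minor r (complete_tree (Suc d) k) G"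
proof -
  let ?H = "complete_tree (Suc d) k"
  let ?V = "tree_nodes d k"
  note embD = tree_embeddingD[OF emb]
  \<comment> \<open>On an arc of the tree the longer list is the child; its downward path is
    reversed for the upward arc.\<close>
  define P where "P u v = (if length u < length v then Q v else rev (Q u))" for u v
  have edge: "u \<in> ?V \<and> v \<in> ?V \<and> (v \<noteq> [] \<and> u = tl v \<and> P u v = Q v \<and> P v u = rev (Q v) \<or>
      u \<noteq> [] \<and> v = tl u \<and> P u v = rev (Q u) \<and> P v u = Q u)" if "u \<rightarrow>\<^bsub>?H\<^esub> v" for u v
  proof -
    from that obtain i where uv: "u \<in> ?V" "v \<in> ?V" and "v = i # u \<or> u = i # v"
      unfolding dominates_complete_tree by blast
    from this(3) show ?thesis using uv by (elim disjE) (simp_all add: P_def)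
  qed
  have ne: "Q c \<noteq> []" if "c \<in> ?V" "c \<noteq> []" for c using embD(3)[OF that] by (simp add: vpath_on_def)
  have vp: "vpath (Q c) G" if "c \<in> ?V" "c \<noteq> []" for c
    using embD(3)[OF that] by (simp add: vpath_iff_vpath_on)
  have "(\<lambda>x y. y \<rightarrow>\<^bsub>G\<^esub> x) = dominates G"
    using arcs_ends_symmetric[OF sym] by (intro ext iffI) 
  then have "successively (dominates G) (rev p) \<longleftrightarrow> successively (dominates G) p" for p
    unfolding successively_rev by (rule arg_cong)
  then have vpr: "vpath (rev (Q c)) G" if "c \<in> ?V" "c \<noteq> []" for c
    using vp[OF that] by (simp add: vpath_iff_vpath_on vpath_on_def del: successively_rev)
  have len: "length (inner_vertices (Q c)) \<le> r" if "c \<in> ?V" "c \<noteq> []" for c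
    using embD(3)[OF that] by (auto simp: inner_vertices_def)
  have tl: "tl c \<in> ?V" if "c \<in> ?V" for c using that by (cases c) (auto simp: tree_nodes_def)
  have path: "vpath (P u v) G \<and> hd (P u v) = \<phi> u \<and> last (P u v) = \<phi> v \<and> P v u = rev (P u v) \<and>
        length (inner_vertices (P u v)) \<le> r \<and> set (inner_vertices (P u v)) \<inter> \<phi> ` ?V = {}"
    if "u \<rightarrow>\<^bsub>?H\<^esub> v" for u v
    using edge[OF that]
  proof (elim conjE disjE)
    assume v: "v \<in> ?V" "v \<noteq> []" and *: "u = tl v" "P u v = Q v" "P v u = rev (Q v)"
    show ?thesis using vp[OF v] len[OF v] embD(3)[OF v] embD(4)[OF v] * by auto
  next
    assume u: "u \<in> ?V" "u \<noteq> []" and *: "v = tl u" "P u v = rev (Q u)" "P v u = Q u"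
    show ?thesis using vpr[OF u] len[OF u] embD(3)[OF u] embD(4)[OF u] ne[OF u] *
      by (auto simp: inner_vertices_rev hd_rev last_rev)
  qed
  have child: "\<exists>c\<in>?V. c \<noteq> [] \<and> {u, v} = {tl c, c} \<and> set (inner_vertices (P u v)) = set (inner_vertices (Q c))"
    if "u \<rightarrow>\<^bsub>?H\<^esub> v" for u v
    using edge[OF that]
  proof (elim conjE disjE)
    assume "v \<in> ?V" "v \<noteq> []" "u = tl v" "P u v = Q v"
    then show ?thesis by (intro bexI[of _ v] conjI) simp_all
  next
    assume "u \<in> ?V" "u \<noteq> []" "v = tl u" "P u v = rev (Q u)"
    then show ?thesis by (intro bexI[of _ u] conjI) (simp_all add: inner_vertices_rev insert_commute)
  qed
  have disjoint: "set (inner_vertices (P u v)) \<inter> set (inner_vertices (P x y)) = {}"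
    if uv: "u \<rightarrow>\<^bsub>?H\<^esub> v" and xy: "x \<rightarrow>\<^bsub>?H\<^esub> y" and ne: "{u, v} \<noteq> {x, y}" for u v x y
  proof -
    obtain c where c: "c \<in> ?V" "c \<noteq> []" "{u, v} = {tl c, c}"
      "set (inner_vertices (P u v)) = set (inner_vertices (Q c))"
      using child[OF uv] by blast
    obtain c' where c': "c' \<in> ?V" "c' \<noteq> []" "{x, y} = {tl c', c'}"
      "set (inner_vertices (P x y)) = set (inner_vertices (Q c'))"
      using child[OF xy] by blast
    have "c \<noteq> c'" using ne c(3) c'(3) by auto
    then show ?thesis using embD(5)[OF c(1,2) c'(1,2)] c(4) c'(4) by simp
  qed
  show ?thesis
    unfolding shallow_topological_minor_def verts_complete_tree
  proof (intro exI conjI)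
    show "inj_on \<phi> ?V" by (rule embD(1))
    show "\<phi> ` ?V \<subseteq> verts G" using embD(2) A by blast
    show "\<forall>u v. u \<rightarrow>\<^bsub>?H\<^esub> v \<longrightarrow> vpath (P u v) G \<and> hd (P u v) = \<phi> u \<and> last (P u v) = \<phi> v \<and>
        P v u = rev (P u v) \<and> length (inner_vertices (P u v)) \<le> r \<and>
        set (inner_vertices (P u v)) \<inter> \<phi> ` ?V = {}"
      by (intro allI impI path)
    show "\<forall>u v x y. u \<rightarrow>\<^bsub>?H\<^esub> v \<and> x \<rightarrow>\<^bsub>?H\<^esub> y \<and> {u, v} \<noteq> {x, y} \<longrightarrow>
        set (inner_vertices (P u v)) \<inter> set (inner_vertices (P x y)) = {}"
      by (intro allI impI disjoint) (elim conjE, assumption)+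
  qed
qed

lemma stm_complete_tree_iff_sdtree:
  assumes "symmetric G"
  shows "shallow_topological_minor r (complete_tree (Suc d) k) G \<longleftrightarrow>
    (\<exists>u A. sdtree (dominates G) r k (verts G) d u A)"
  using stm_complete_tree_imp_sdtree sdtree_imp_tree_embedding tree_embedding_imp_stm[OF assms] sdtree_subset
  by metis

section \<open>Elementary bounds\<close>

text \<open>Sums, products and powers enter the class as binary functions; composition brings them
  back to unary ones.\<close>

definition elementary2 :: "(nat \<Rightarrow> nat \<Rightarrow> nat) \<Rightarrow> bool" where
  "elementary2 h \<longleftrightarrow> (\<exists>H. kalmar_elementary 2 H \<and> (\<forall>x y. h x y = H [x, y]))"

lemma elementary2_comp:
  assumes "elementary2 h" "elementary f" "elementary g"
  shows "elementary (\<lambda>n. h (f n) (g n))"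
proof -
  from assms obtain H F G where *: "kalmar_elementary 2 H" "\<And>x y. h x y = H [x, y]"
    "kalmar_elementary 1 F" "\<And>n. f n = F [n]" "kalmar_elementary 1 G" "\<And>n. g n = G [n]"
    unfolding elementary_def elementary2_def by blast
  have "kalmar_elementary 1 (\<lambda>xs. H (map (\<lambda>f. f xs) [F, G]))"
    by (rule kalmar_elementary.comp[OF *(1)]) (use *(3,5) in auto)
  then show ?thesis unfolding elementary_def using *(2,4,6)
    by (intro exI[of _ "\<lambda>xs. H (map (\<lambda>f. f xs) [F, G])"]) simp
qed

lemma elementary2_comp2:
  assumes "elementary2 h" "elementary2 f" "elementary2 g"
  shows "elementary2 (\<lambda>x y. h (f x y) (g x y))"
proof -
  from assms obtain H F G where *: "kalmar_elementary 2 H" "\<And>x y. h x y = H [x, y]"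
    "kalmar_elementary 2 F" "\<And>x y. f x y = F [x, y]" "kalmar_elementary 2 G" "\<And>x y. g x y = G [x, y]"
    unfolding elementary2_def by blast
  have "kalmar_elementary 2 (\<lambda>xs. H (map (\<lambda>f. f xs) [F, G]))"
    by (rule kalmar_elementary.comp[OF *(1)]) (use *(3,5) in auto)
  then show ?thesis unfolding elementary2_def using *(2,4,6)
    by (intro exI[of _ "\<lambda>xs. H (map (\<lambda>f. f xs) [F, G])"]) simp
qed

lemma elementary_comp:
  assumes "elementary h" "elementary f"
  shows "elementary (\<lambda>n. h (f n))"
proof -
  from assms obtain H F where *: "kalmar_elementary 1 H" "\<And>x. h x = H [x]"
    "kalmar_elementary 1 F" "\<And>n. f n = F [n]"
    unfolding elementary_def by blast
  have "kalmar_elementary 1 (\<lambda>xs. H (map (\<lambda>f. f xs) [F]))"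
    by (rule kalmar_elementary.comp[OF *(1)]) (use *(3) in auto)
  then show ?thesis unfolding elementary_def using *(2,4)
    by (intro exI[of _ "\<lambda>xs. H (map (\<lambda>f. f xs) [F])"]) simp
qed

lemma elementary_comp2:
  assumes "elementary h" "elementary2 f"
  shows "elementary2 (\<lambda>x y. h (f x y))"
proof -
  from assms obtain H F where *: "kalmar_elementary 1 H" "\<And>x. h x = H [x]"
    "kalmar_elementary 2 F" "\<And>x y. f x y = F [x, y]"
    unfolding elementary_def elementary2_def by blast
  have "kalmar_elementary 2 (\<lambda>xs. H (map (\<lambda>f. f xs) [F]))"
    by (rule kalmar_elementary.comp[OF *(1)]) (use *(3) in auto)
  then show ?thesis unfolding elementary2_def using *(2,4)
    by (intro exI[of _ "\<lambda>xs. H (map (\<lambda>f. f xs) [F])"]) simp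
qed

lemma elementary_Suc: "elementary Suc"
  unfolding elementary_def using kalmar_elementary.succ by fastforce

lemma elementary_id: "elementary (\<lambda>n. n)"
  unfolding elementary_def by (intro exI[of _ "\<lambda>xs. xs ! 0"]) (simp add: kalmar_elementary.proj)

lemma elementary_const: "elementary (\<lambda>_. c)"
proof (induction c)
  case 0
  show ?case unfolding elementary_def using kalmar_elementary.zero by blast
next
  case (Suc c)
  from elementary_comp[OF elementary_Suc this] show ?case .
qed

lemma elementary2_proj: "elementary2 (\<lambda>x y. x)" "elementary2 (\<lambda>x y. y)"
  unfolding elementary2_def using kalmar_elementary.proj[of 0 2] kalmar_elementary.proj[of 1 2]
  by fastforce+

lemma elementary2_diff: "elementary2 (-)"
  unfolding elementary2_def using kalmar_elementary.diff by fastforce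

text \<open>The bounded sum of the constant \<open>y\<close> over i <= x has \<open>x + 1\<close>
  terms.\<close>

lemma elementary2_Suc_times: "elementary2 (\<lambda>x y. Suc x * y)"
proof -
  have "kalmar_elementary (Suc 1) (\<lambda>xs. \<Sum>i\<le>hd xs. (\<lambda>xs. xs ! 1) (i # tl xs))"
    by (rule kalmar_elementary.bsum, rule kalmar_elementary.proj) simp
  then show ?thesis unfolding elementary2_def numeral_2_eq_2
    by (intro exI[of _ "\<lambda>xs. \<Sum>i\<le>hd xs. (\<lambda>xs. xs ! 1) (i # tl xs)"]) simp
qed

text \<open>Likewise, the bounded product of the constant \<open>y\<close> has \<open>x + 1\<close>
  factors.\<close>

lemma elementary2_power_Suc: "elementary2 (\<lambda>x y. y ^ Suc x)"
proof -
  have "kalmar_elementary (Suc 1) (\<lambda>xs. \<Prod>i\<le>hd xs. (\<lambda>xs. xs ! 1) (i # tl xs))"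
    by (rule kalmar_elementary.bprod, rule kalmar_elementary.proj) simp
  then show ?thesis unfolding elementary2_def numeral_2_eq_2
    by (intro exI[of _ "\<lambda>xs. \<Prod>i\<le>hd xs. (\<lambda>xs. xs ! 1) (i # tl xs)"]) simp
qed

lemma elementary2_times: "elementary2 (*)"
  using elementary2_comp2[OF elementary2_diff elementary2_Suc_times elementary2_proj(2)] by simp

lemma elementary2_plus: "elementary2 (+)"
proof -
  \<comment> \<open>Addition is recovered from (x + 1)(y + 1) - xy - 1, where
    \<open>Suc (x - x)\<close> is the constant 1 as a binary function.\<close>
  have "elementary2 (\<lambda>x y. (Suc x * Suc y - x * y) - Suc (x - x))"
    by (intro elementary2_comp2[OF elementary2_diff] elementary2_comp2[OF elementary2_times]
          elementary_comp2[OF elementary_Suc] elementary2_proj)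
  moreover have "(Suc x * Suc y - x * y) - Suc (x - x) = x + y" for x y :: nat by simp
  ultimately show ?thesis by simp
qed

lemma elementary_add: "elementary f \<Longrightarrow> elementary g \<Longrightarrow> elementary (\<lambda>n. f n + g n)"
  by (rule elementary2_comp[OF elementary2_plus])

lemma elementary_mult: "elementary f \<Longrightarrow> elementary g \<Longrightarrow> elementary (\<lambda>n. f n * g n)"
  by (rule elementary2_comp[OF elementary2_times])

lemma elementary_power_Suc: "elementary f \<Longrightarrow> elementary g \<Longrightarrow> elementary (\<lambda>n. f n ^ Suc (g n))"
  by (rule elementary2_comp[OF elementary2_power_Suc])

lemmas elementary_intros =
  elementary_add elementary_mult elementary_power_Suc elementary_const elementary_id
  elementary_comp[OF elementary_Suc]

lemma elementary_sdtree_size: "elementary k \<Longrightarrow> elementary (\<lambda>r. sdtree_size r (k r) d)"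
  by (induction d) (simp_all del: One_nat_def plus_1_eq_Suc add_2_eq_Suc' add: elementary_intros)

lemma elementary_family_bound: "elementary k \<Longrightarrow> elementary (\<lambda>r. family_bound r (k r))"
  unfolding family_bound_def by (intro elementary_intros)

text \<open>\<open>d\<close> is a constant, so the recursion unfolds to a fixed expression.
  \<open>k\<close> has to be a function of \<open>r\<close>, because the recursion replaces it by
  \<open>k r + r\<close>.\<close>

lemma elementary_batch_bound: "elementary k \<Longrightarrow> elementary (\<lambda>r. batch_bound r (k r) d)"
proof (induction d arbitrary: k)
  case (Suc d)
  then show ?case
    unfolding batch_bound.simps
    by (intro elementary_intros elementary_family_bound elementary_sdtree_size Suc.IH)
qed (simp add: elementary_const)

section \<open>Rooted trees\<close>

text \<open>Two paths that part after a common vertex \<open>a\<close> meet again. Up to the first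
  vertex \<open>z\<close> of one path that lies on the other, they form a cycle through
  \<open>a\<close> and \<open>z\<close>.\<close>

lemma undirected_acyclic_path_unique:
  assumes sym: "symmetric T" and acyc: "undirected_acyclic T"
  shows "vpath p T \<Longrightarrow> vpath q T \<Longrightarrow> hd p = hd q \<Longrightarrow> last p = last q \<Longrightarrow> p = q"
proof (induction p arbitrary: q)
  case Nil
  then show ?case by (simp add: vpath_iff_vpath_on vpath_on_def)
next
  case (Cons a p)
  from Cons.prems obtain q' where q: "q = a # q'"
    by (cases q) (auto simp: vpath_iff_vpath_on vpath_on_def)
  note v = Cons.prems(1,2)[unfolded vpath_iff_vpath_on vpath_on_def q]
  show ?case
  proof (cases "p = [] \<or> q' = []")
    case True
    then show ?thesis using Cons.prems(4) v q last_in_set[of p] last_in_set[of q'] by (auto split: if_splits)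
  next
    case False
    then have ne: "p \<noteq> []" "q' \<noteq> []" by simp_all
    have vp: "vpath p T" "vpath q' T" and last: "last p = last q'"
      using v ne Cons.prems(4) q by (auto simp: vpath_iff_vpath_on vpath_on_def successively_Cons)
    show ?thesis
    proof (cases "hd p = hd q'")
      case True
      then show ?thesis using Cons.IH[OF vp True last] q by simp
    next
      case hd: False
      have "\<exists>x\<in>set p. x \<in> set q'" using last ne by (metis last_in_set)
      then obtain p1 z p2 where p: "p = p1 @ z # p2" and z: "z \<in> set q'" and p1: "\<forall>y\<in>set p1. y \<notin> set q'"
        by (rule split_list_first_propE)
      from z obtain q1 q2 where q': "q' = q1 @ z # q2" by (meson split_list)
      have sy: "(\<lambda>x y. y \<rightarrow>\<^bsub>T\<^esub> x) = dominates T"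
        using arcs_ends_symmetric[OF sym] by (intro ext iffI)
      have succ: "successively (dominates T) (a # p1 @ z # p2)" "successively (dominates T) (a # q1 @ z # q2)"
        using v p q' by simp_all
      have "successively (dominates T) (rev (a # q1 @ [z]))"
        unfolding successively_rev sy
        using succ(2) successively_append_iff[of "dominates T" "a # q1 @ [z]" q2] by simp
      then have q1: "successively (dominates T) (z # rev q1 @ [a])" by simp
      have p1': "successively (dominates T) (a # p1 @ [z])"
        using succ(1) successively_append_iff[of "dominates T" "a # p1 @ [z]" p2] by simp
      let ?c = "a # p1 @ z # rev q1"
      have "vpath ?c T"
      proof -
        have "distinct ?c" using v p q' p1 by auto
        moreover have "set ?c \<subseteq> verts T" using v p q' by auto
        moreover have "successively (dominates T) ?c"
        proof -
          have "successively (dominates T) (z # rev q1)" using q1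
            by (metis append_Cons successively_append_iff)
          moreover have "successively (dominates T) (a # p1)" "last (a # p1) \<rightarrow>\<^bsub>T\<^esub> z"
            using p1' successively_append_iff[of "dominates T" "a # p1" "[z]"] by auto
          ultimately show ?thesis
            using successively_append_iff[of "dominates T" "a # p1" "z # rev q1"] by simp
        qed
        ultimately show ?thesis by (simp add: vpath_iff_vpath_on vpath_on_def)
      qed
      \<comment> \<open>As the paths part right after \<open>a\<close>, \<open>p1\<close> and
        \<open>q1\<close> are not both empty.\<close>
      moreover have "length ?c \<ge> 3" using hd p q' by (cases p1; cases q1) auto
      moreover have "last ?c \<rightarrow>\<^bsub>T\<^esub> hd ?c"
        using q1 successively_append_iff[of "dominates T" "z # rev q1" "[a]"] by simp
      ultimately show ?thesis using acyc unfolding undirected_acyclic_def by blast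
    qed
  qed
qed

section \<open>Rooted trees inside complete trees\<close>

context
  fixes T :: "('a, 'b) pre_digraph" and \<rho> :: 'a
  assumes tree: "rooted_tree T \<rho>"
begin

interpretation T: graph T
  using tree by (simp add: rooted_tree_def)

lemma rooted_tree_ex_path:
  assumes "v \<in> verts T"
  shows "\<exists>p. vpath p T \<and> hd p = \<rho> \<and> last p = v"
proof -
  have "strongly_connected T"
    using T.symmetric_connected_imp_strongly_connected[OF T.sym_arcs] tree by (simp add: rooted_tree_def)
  then have "\<rho> \<rightarrow>\<^sup>*\<^bsub>T\<^esub> v" using tree assms by (auto simp: rooted_tree_def)
  then obtain q where q: "T.awalk \<rho> q v" using T.reachable_awalk by blast
  from T.awalk_imp_vwalk[OF this] have "vwalk (T.awalk_verts \<rho> q) T" .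
  moreover have "hd (T.awalk_verts \<rho> q) = \<rho>" "last (T.awalk_verts \<rho> q) = v" using q by auto
  ultimately show ?thesis by (rule vwalk_imp_ex_vpath)
qed

text \<open>An edge back to a vertex before the predecessor of the last one would close a cycle with
  at least three vertices.\<close>

lemma rooted_tree_path_step:
  assumes p: "vpath p T" and w: "last p \<rightarrow>\<^bsub>T\<^esub> w"
  shows "w \<notin> set p \<and> vpath (p @ [w]) T \<or> (\<exists>a. p = a @ [w, last p])"
proof (cases "w \<in> set p")
  case False
  have "w \<in> verts T" using w T.adj_in_verts by blast
  then show ?thesis using False p w
    by (auto simp: vpath_iff_vpath_on vpath_on_def successively_append_iff)
next
  case True
  then obtain a b where ab: "p = a @ w # b" by (meson split_list)
  have "w \<noteq> last p" using w T.adj_not_same by metis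
  then have b: "b \<noteq> []" using ab by auto
  have "vpath (w # b) T" using p ab
    by (auto simp: vpath_iff_vpath_on intro: vpath_on_suffix)
  moreover have "last (w # b) \<rightarrow>\<^bsub>T\<^esub> hd (w # b)" using w ab by simp
  ultimately have "\<not> 3 \<le> length (w # b)"
    using tree unfolding rooted_tree_def undirected_acyclic_def by blast
  then obtain x where "b = [x]" using b by (cases b) (auto simp: not_less_eq_eq)
  then show ?thesis using ab by simp
qed

text \<open>\<open>tree_depth\<close> looks only at paths to leaves. A longest path from the root
  ends in a leaf, since the only possible neighbour of its end is the predecessor.\<close>

lemma rooted_tree_path_length:
  assumes "vpath p T" "hd p = \<rho>"
  shows "length p \<le> tree_depth T \<rho>"
proof -
  have bound: "length q \<le> card (verts T)" if "vpath q T" for q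
    using that unfolding vpath_iff_vpath_on vpath_on_def
    by (metis T.finite_verts card_mono distinct_card)
  have "\<exists>q. (vpath q T \<and> hd q = \<rho>) \<and> (\<forall>q'. vpath q' T \<and> hd q' = \<rho> \<longrightarrow> length q' \<le> length q)"
    using bound assms by (intro ex_has_greatest_nat[where b = "Suc (card (verts T))"]) (auto simp: less_Suc_eq_le)
  then obtain q where q: "vpath q T" "hd q = \<rho>" and max: "\<And>q'. vpath q' T \<Longrightarrow> hd q' = \<rho> \<Longrightarrow> length q' \<le> length q"
    by blast
  have qne: "q \<noteq> []" and dq: "distinct q" and sq: "set q \<subseteq> verts T" and succ: "successively (dominates T) q"
    using q(1) by (auto simp: vpath_iff_vpath_on vpath_on_def)
  let ?v = "last q"
  have nb: "\<exists>a. q = a @ [w, ?v]" if "?v \<rightarrow>\<^bsub>T\<^esub> w" for w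
  proof -
    have "\<not> vpath (q @ [w]) T" using max[of "q @ [w]"] qne q(2) by auto
    then show ?thesis using rooted_tree_path_step[OF q(1) that] by blast
  qed
  \<comment> \<open>\<open>out_degree\<close> counts arcs; without parallel arcs this is the number
    of neighbours.\<close>
  have out: "out_degree T ?v = card {w. ?v \<rightarrow>\<^bsub>T\<^esub> w}"
  proof -
    have "inj_on (head T) (out_arcs T ?v)"
      by (rule inj_onI) (auto simp: arc_to_ends_def intro!: T.no_multi_arcs)
    moreover have "head T ` out_arcs T ?v = {w. ?v \<rightarrow>\<^bsub>T\<^esub> w}" by (force simp: arcs_ends_conv)
    ultimately show ?thesis unfolding out_degree_def by (metis card_image)
  qed
  have "tree_leaf T \<rho> ?v"
  proof (cases "tl q = []")
    case True
    then have "q = [\<rho>]" using qne q(2) by (cases q) auto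
    then have "{w. ?v \<rightarrow>\<^bsub>T\<^esub> w} = {}" using nb by auto
    then show ?thesis using out \<open>q = [\<rho>]\<close> sq by (simp add: tree_leaf_def)
  next
    case False
    then obtain a u where au: "q = a @ [u, ?v]"
      by (metis append_butlast_last_id append.assoc append_Cons append_Nil butlast_tl list.sel(2) qne tl_Nil butlast.simps(2) list.exhaust_sel)
    have "u \<rightarrow>\<^bsub>T\<^esub> ?v" using succ by (subst (asm) au) (simp add: successively_append_iff)
    then have "?v \<rightarrow>\<^bsub>T\<^esub> u" using arcs_ends_symmetric[OF T.sym_arcs] by blast
    moreover have "w = u" if "?v \<rightarrow>\<^bsub>T\<^esub> w" for w using nb[OF that] au by (metis append1_eq_conv append.assoc append_Cons append_Nil)
    ultimately have "{w. ?v \<rightarrow>\<^bsub>T\<^esub> w} = {u}" by blast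
    moreover have "?v \<noteq> \<rho>" using dq q(2) False qne by (metis distinct.simps(2) last_in_set last_tl list.exhaust_sel)
    ultimately show ?thesis using out sq qne by (auto simp: tree_leaf_def)
  qed
  then have "length q \<in> {length p | p. vpath p T \<and> hd p = \<rho> \<and> tree_leaf T \<rho> (last p)}"
    using q by blast
  moreover have "finite {length p | p. vpath p T \<and> hd p = \<rho> \<and> tree_leaf T \<rho> (last p)}"
  proof (rule finite_subset)
    show "{length p | p. vpath p T \<and> hd p = \<rho> \<and> tree_leaf T \<rho> (last p)} \<subseteq> {..card (verts T)}"
      by (intro subsetI, elim CollectE exE conjE) (simp add: bound)
  qed simp
  ultimately have "length q \<le> tree_depth T \<rho>" unfolding tree_depth_def by (rule Max_ge[rotated])
  then show ?thesis using max[OF assms] by simp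
qed

text \<open>A vertex is addressed by the labels along its unique path from the root. One injective
  numbering of all vertices labels the children everywhere, so \<open>k = card (verts T)\<close>
  suffices.\<close>

lemma rooted_tree_embeds_complete_tree:
  assumes depth: "tree_depth T \<rho> = Suc d"
  shows "\<exists>k \<psi>. inj_on \<psi> (verts T) \<and> \<psi> ` verts T \<subseteq> verts (complete_tree (Suc d) k) \<and>
     (\<forall>u v. u \<rightarrow>\<^bsub>T\<^esub> v \<longrightarrow> \<psi> u \<rightarrow>\<^bsub>complete_tree (Suc d) k\<^esub> \<psi> v)"
proof -
  obtain path where path: "\<And>v. v \<in> verts T \<Longrightarrow> vpath (path v) T \<and> hd (path v) = \<rho> \<and> last (path v) = v"
    using rooted_tree_ex_path by metis
  have unique: "p = path v" if "vpath p T" "hd p = \<rho>" "last p = v" for p v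
  proof -
    have "v \<in> verts T" using that last_in_set by (fastforce simp: vpath_iff_vpath_on vpath_on_def)
    then show ?thesis
      using undirected_acyclic_path_unique[of T p "path v"] path[of v] that tree T.sym_arcs
      by (simp add: rooted_tree_def)
  qed
  obtain idx where idx: "inj_on idx (verts T)" "idx ` verts T \<subseteq> {..<card (verts T)}"
    by (metis T.finite_verts card_le_inj card_lessThan finite_lessThan order_refl)
  \<comment> \<open>The root is dropped, as it starts every path and has the address
    \<open>[]\<close>; reversal matches the encoding of \<open>complete_tree\<close>.\<close>
  define \<psi> where "\<psi> v = rev (map idx (tl (path v)))" for v
  have pathD: "path v \<noteq> []" "set (path v) \<subseteq> verts T" "path v = \<rho> # tl (path v)" if "v \<in> verts T" for v
  proof -
    show ne: "path v \<noteq> []" and "set (path v) \<subseteq> verts T"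
      using path[OF that] by (auto simp: vpath_iff_vpath_on vpath_on_def)
    show "path v = \<rho> # tl (path v)" using path[OF that] ne by (metis list.collapse)
  qed
  have tlD: "set (tl (path v)) \<subseteq> verts T" if "v \<in> verts T" for v
    using pathD(2,3)[OF that] by (metis set_subset_Cons subset_trans)
  have nodes: "\<psi> v \<in> tree_nodes d (card (verts T))" if "v \<in> verts T" for v
  proof -
    have "length (path v) \<le> Suc d" using rooted_tree_path_length[of "path v"] path[OF that] depth by simp
    then have "length (\<psi> v) \<le> d" by (simp add: \<psi>_def)
    moreover have "set (\<psi> v) \<subseteq> {..<card (verts T)}"
      using tlD[OF that] idx(2) by (auto simp: \<psi>_def)
    ultimately show ?thesis by (simp add: tree_nodes_def)
  qed
  have inj: "inj_on \<psi> (verts T)"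
  proof (rule inj_onI)
    fix u v assume uv: "u \<in> verts T" "v \<in> verts T" "\<psi> u = \<psi> v"
    then have "map idx (tl (path u)) = map idx (tl (path v))" by (simp add: \<psi>_def)
    moreover have "inj_on idx (set (tl (path u)) \<union> set (tl (path v)))"
      using idx(1) tlD[OF uv(1)] tlD[OF uv(2)] by (meson inj_on_subset le_sup_iff)
    ultimately have "tl (path u) = tl (path v)" by (simp add: inj_on_map_eq_map)
    then have "path u = path v" using pathD(3) uv by metis
    then show "u = v" using path uv by metis
  qed
  have snoc: "\<psi> v = idx v # \<psi> u" if "path v = path u @ [v]" "u \<in> verts T" for u v
    using that pathD(1)[of u] by (simp add: \<psi>_def)
  have "\<psi> u \<rightarrow>\<^bsub>complete_tree (Suc d) (card (verts T))\<^esub> \<psi> v" if uv: "u \<rightarrow>\<^bsub>T\<^esub> v" for u v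
  proof -
    have V: "u \<in> verts T" "v \<in> verts T" using T.adj_in_verts[OF uv] by simp_all
    have "path v = path u @ [v] \<or> path u = path v @ [u]"
    proof -
      have pu: "vpath (path u) T" "hd (path u) = \<rho>" "last (path u) = u" using path[OF V(1)] by auto
      from rooted_tree_path_step[OF pu(1), of v] uv pu(3)
      consider "vpath (path u @ [v]) T" | a where "path u = a @ [v, u]" by auto
      then show ?thesis
      proof cases
        case 1
        then have "path u @ [v] = path v" using pu(2) pathD(1)[OF V(1)] by (intro unique) auto
        then show ?thesis by simp
      next
        case 2
        have "vpath (a @ [v]) T"
          using pu(1) unfolding 2 vpath_iff_vpath_on vpath_on_def by (auto simp: successively_append_iff)
        moreover have "hd (a @ [v]) = \<rho>" using pu(2) 2 by (cases a) auto
        ultimately have "a @ [v] = path v" by (intro unique) auto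
        then show ?thesis using 2 by (metis append.assoc append_Cons append_Nil)
      qed
    qed
    then show ?thesis
      using snoc V nodes[OF V(1)] nodes[OF V(2)] unfolding dominates_complete_tree by blast
  qed
  then show ?thesis using inj nodes unfolding verts_complete_tree by blast
qed

end

text \<open>The model of \<open>H\<close> is restricted along \<open>\<psi>\<close>. Injectivity
  keeps distinct edges distinct, so their paths remain internally disjoint.\<close>

lemma stm_embed:
  assumes wf: "wf_digraph T" and inj: "inj_on \<psi> (verts T)" and img: "\<psi> ` verts T \<subseteq> verts H"
    and hom: "\<And>u v. u \<rightarrow>\<^bsub>T\<^esub> v \<Longrightarrow> \<psi> u \<rightarrow>\<^bsub>H\<^esub> \<psi> v"
    and minor: "shallow_topological_minor r H G"
  shows "shallow_topological_minor r T G"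
proof -
  from minor obtain \<phi> P where inj': "inj_on \<phi> (verts H)" and img': "\<phi> ` verts H \<subseteq> verts G"
    and path: "\<And>u v. u \<rightarrow>\<^bsub>H\<^esub> v \<Longrightarrow> vpath (P u v) G \<and> hd (P u v) = \<phi> u \<and> last (P u v) = \<phi> v \<and>
        P v u = rev (P u v) \<and>
        length (inner_vertices (P u v)) \<le> r \<and> set (inner_vertices (P u v)) \<inter> \<phi> ` verts H = {}"
    and disj: "\<And>u v x y. u \<rightarrow>\<^bsub>H\<^esub> v \<Longrightarrow> x \<rightarrow>\<^bsub>H\<^esub> y \<Longrightarrow> {u, v} \<noteq> {x, y} \<Longrightarrow>
        set (inner_vertices (P u v)) \<inter> set (inner_vertices (P x y)) = {}"
    unfolding shallow_topological_minor_def by metis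
  have sub: "(\<phi> \<circ> \<psi>) ` verts T \<subseteq> \<phi> ` verts H" using img by auto
  have ends: "{\<psi> u, \<psi> v} \<noteq> {\<psi> x, \<psi> y}"
    if "u \<rightarrow>\<^bsub>T\<^esub> v" "x \<rightarrow>\<^bsub>T\<^esub> y" "{u, v} \<noteq> {x, y}" for u v x y
  proof
    assume "{\<psi> u, \<psi> v} = {\<psi> x, \<psi> y}"
    then have "\<psi> ` {u, v} = \<psi> ` {x, y}" by simp
    moreover have "{u, v} \<subseteq> verts T" "{x, y} \<subseteq> verts T"
      using that(1,2) wf_digraph.adj_in_verts[OF wf] by auto
    ultimately have "{u, v} = {x, y}" using inj_on_image_eq_iff[OF inj] by blast
    then show False using that(3) by simp
  qed
  show ?thesis
    unfolding shallow_topological_minor_def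
  proof (intro exI conjI)
    show "inj_on (\<phi> \<circ> \<psi>) (verts T)" using inj inj' img by (meson comp_inj_on inj_on_subset)
    show "(\<phi> \<circ> \<psi>) ` verts T \<subseteq> verts G" using sub img' by blast
    show "\<forall>u v. u \<rightarrow>\<^bsub>T\<^esub> v \<longrightarrow> vpath (P (\<psi> u) (\<psi> v)) G \<and> hd (P (\<psi> u) (\<psi> v)) = (\<phi> \<circ> \<psi>) u \<and>
        last (P (\<psi> u) (\<psi> v)) = (\<phi> \<circ> \<psi>) v \<and> P (\<psi> v) (\<psi> u) = rev (P (\<psi> u) (\<psi> v)) \<and>
        length (inner_vertices (P (\<psi> u) (\<psi> v))) \<le> r \<and>
        set (inner_vertices (P (\<psi> u) (\<psi> v))) \<inter> (\<phi> \<circ> \<psi>) ` verts T = {}"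
    proof (intro allI impI)
      fix u v assume "u \<rightarrow>\<^bsub>T\<^esub> v"
      note p = path[OF hom[OF this]]
      have "set (inner_vertices (P (\<psi> u) (\<psi> v))) \<inter> (\<phi> \<circ> \<psi>) ` verts T = {}" using p sub by blast
      with p show "vpath (P (\<psi> u) (\<psi> v)) G \<and> hd (P (\<psi> u) (\<psi> v)) = (\<phi> \<circ> \<psi>) u \<and>
        last (P (\<psi> u) (\<psi> v)) = (\<phi> \<circ> \<psi>) v \<and> P (\<psi> v) (\<psi> u) = rev (P (\<psi> u) (\<psi> v)) \<and>
        length (inner_vertices (P (\<psi> u) (\<psi> v))) \<le> r \<and>
        set (inner_vertices (P (\<psi> u) (\<psi> v))) \<inter> (\<phi> \<circ> \<psi>) ` verts T = {}"
        by simp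
    qed
    show "\<forall>u v x y. u \<rightarrow>\<^bsub>T\<^esub> v \<and> x \<rightarrow>\<^bsub>T\<^esub> y \<and> {u, v} \<noteq> {x, y} \<longrightarrow>
        set (inner_vertices (P (\<psi> u) (\<psi> v))) \<inter> set (inner_vertices (P (\<psi> x) (\<psi> y))) = {}"
      using disj hom ends by (intro allI impI, elim conjE) simp
  qed
qed

section \<open>Rooted trees given by a parent function\<close>

locale parent_function =
  fixes V :: "'a set" and \<rho> :: 'a and par :: "'a \<Rightarrow> 'a" and h :: "'a \<Rightarrow> nat"
  assumes fin: "finite V" and root: "\<rho> \<in> V" "h \<rho> = 0"
    and par: "\<And>x. x \<in> V \<Longrightarrow> x \<noteq> \<rho> \<Longrightarrow> par x \<in> V \<and> h x = Suc (h (par x))"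
begin

text \<open>The height \<open>h\<close> certifies a tree: parents are strictly lower, so every
  vertex is connected to \<open>\<rho>\<close>, and a highest vertex cannot lie on a cycle.\<close>

definition parent_tree :: "('a, 'a \<times> 'a) pre_digraph" where
  "parent_tree = with_proj \<lparr> pverts = V,
     parcs = {(x, y) \<in> V \<times> V. x \<noteq> \<rho> \<and> y = par x \<or> y \<noteq> \<rho> \<and> x = par y} \<rparr>"

lemma verts_parent_tree: "verts parent_tree = V"
  by (simp add: parent_tree_def)

lemma dominates_parent_tree:
  "x \<rightarrow>\<^bsub>parent_tree\<^esub> y \<longleftrightarrow> x \<in> V \<and> y \<in> V \<and> (x \<noteq> \<rho> \<and> y = par x \<or> y \<noteq> \<rho> \<and> x = par y)"
  by (auto simp: parent_tree_def)

lemma parent_tree_lower_neighbour: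
  assumes "x \<rightarrow>\<^bsub>parent_tree\<^esub> y" "h y \<le> h x"
  shows "x \<noteq> \<rho>" "y = par x"
  using assms par[of x] par[of y] unfolding dominates_parent_tree by auto

lemma symmetric_parent_tree: "symmetric parent_tree"
  unfolding symmetric_def sym_def dominates_parent_tree by blast

lemma graph_parent_tree: "graph parent_tree"
proof -
  have "finite {(x, y) \<in> V \<times> V. x \<noteq> \<rho> \<and> y = par x \<or> y \<noteq> \<rho> \<and> x = par y}"
    by (rule finite_subset[of _ "V \<times> V"]) (use fin in auto)
  moreover have "par x \<noteq> x" "x \<noteq> par x" if "x \<in> V" "x \<noteq> \<rho>" for x
    using par[OF that] by (metis n_not_Suc_n)+
  ultimately have "digraph parent_tree"
    by unfold_locales (use fin in \<open>auto simp: parent_tree_def arc_to_ends_def\<close>)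
  then show ?thesis by (rule digraph.graphI) (rule symmetric_parent_tree)
qed

interpretation P: graph parent_tree
  by (rule graph_parent_tree)

text \<open>A path from the root can only climb: its first step down would lead to the parent of the
  current vertex, which is the vertex just left.\<close>

lemma parent_tree_path_height:
  assumes p: "vpath p parent_tree" and hd: "hd p = \<rho>"
  shows "i < length p \<Longrightarrow> h (p ! i) = i"
proof (induction i rule: less_induct)
  case (less i)
  have adj: "p ! j \<rightarrow>\<^bsub>parent_tree\<^esub> p ! Suc j" if "Suc j < length p" for j
    using p that by (simp add: vpath_iff_vpath_on vpath_on_def successively_conv_nth)
  show ?case
  proof (cases i)
    case 0
    then show ?thesis using less.prems hd root by (simp add: hd_conv_nth)
  next
    case (Suc j)
    have hj: "h (p ! j) = j" using less Suc by simp
    have a: "p ! j \<rightarrow>\<^bsub>parent_tree\<^esub> p ! i" using adj[of j] less.prems Suc by simp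
    show ?thesis
    proof (cases "h (p ! i) \<le> h (p ! j)")
      case True
      from parent_tree_lower_neighbour[OF a True] have *: "p ! j \<noteq> \<rho>" "p ! i = par (p ! j)" .
      then obtain l where l: "j = Suc l"
        using hd p by (cases j) (auto simp: hd_conv_nth vpath_iff_vpath_on vpath_on_def)
      have "h (p ! l) = l" using less Suc l by simp
      moreover have "p ! j \<rightarrow>\<^bsub>parent_tree\<^esub> p ! l"
        using adj[of l] less.prems Suc l arcs_ends_symmetric[OF symmetric_parent_tree] by simp
      ultimately have "p ! l = par (p ! j)" using parent_tree_lower_neighbour(2) hj l by simp
      then have "p ! l = p ! i" using * by simp
      then have False using p less.prems Suc l
        by (simp add: vpath_iff_vpath_on vpath_on_def nth_eq_iff_index_eq)
      then show ?thesis ..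
    next
      case False
      then show ?thesis using a hj Suc par[of "p ! j"] par[of "p ! i"] unfolding dominates_parent_tree by auto
    qed
  qed
qed

text \<open>Both neighbours of a highest vertex on a cycle would be its parent.\<close>

lemma undirected_acyclic_parent_tree: "undirected_acyclic parent_tree"
  unfolding undirected_acyclic_def
proof
  assume "\<exists>p. vpath p parent_tree \<and> 3 \<le> length p \<and> last p \<rightarrow>\<^bsub>parent_tree\<^esub> hd p"
  then obtain p where p: "vpath p parent_tree" "3 \<le> length p" "last p \<rightarrow>\<^bsub>parent_tree\<^esub> hd p" by blast
  let ?n = "length p"
  have d: "distinct p" "p \<noteq> []" using p(1) by (auto simp: vpath_iff_vpath_on vpath_on_def)
  define nx where "nx i = (if Suc i = ?n then 0 else Suc i)" for i
  have step: "p ! i \<rightarrow>\<^bsub>parent_tree\<^esub> p ! nx i" if "i < ?n" for i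
  proof (cases "Suc i = ?n")
    case True
    then have "i = ?n - 1" by simp
    then show ?thesis using p(3) d(2) True by (simp add: nx_def hd_conv_nth last_conv_nth)
  next
    case False
    then show ?thesis using p(1) that
      by (simp add: nx_def vpath_iff_vpath_on vpath_on_def successively_conv_nth)
  qed
  let ?I = "(\<lambda>i. h (p ! i)) ` {..<?n}"
  have "Max ?I \<in> ?I" using d(2) by (intro Max_in) auto
  then obtain m where m: "m < ?n" "Max ?I = h (p ! m)" by auto
  have max: "h (p ! i) \<le> h (p ! m)" if "i < ?n" for i
    unfolding m(2)[symmetric] using that by (intro Max_ge) auto
  define m' where "m' = (if m = 0 then ?n - 1 else m - 1)"
  \<comment> \<open>On a cycle with at least three vertices the predecessor and the successor of a
    position differ.\<close>
  have m': "m' < ?n" "nx m' = m" "nx m < ?n" "nx m \<noteq> m'"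
    using m(1) p(2) by (auto simp: m'_def nx_def)
  have "p ! nx m = par (p ! m)" using parent_tree_lower_neighbour(2)[OF step[OF m(1)] max[OF m'(3)]] .
  moreover have "p ! m \<rightarrow>\<^bsub>parent_tree\<^esub> p ! m'"
    using step[OF m'(1)] m'(2) arcs_ends_symmetric[OF symmetric_parent_tree] by simp
  then have "p ! m' = par (p ! m)" using parent_tree_lower_neighbour(2) max[OF m'(1)] by blast
  ultimately have "p ! nx m = p ! m'" by simp
  then show False using d(1) m' by (simp add: nth_eq_iff_index_eq)
qed

lemma rooted_tree_parent_tree: "rooted_tree parent_tree \<rho>"
proof -
  have reach: "\<rho> \<rightarrow>\<^sup>*\<^bsub>parent_tree\<^esub> x" if "x \<in> V" for x
    using that
  proof (induction "h x" arbitrary: x rule: less_induct)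
    case less
    show ?case
    proof (cases "x = \<rho>")
      case True
      then show ?thesis using root by (simp add: verts_parent_tree)
    next
      case False
      have "\<rho> \<rightarrow>\<^sup>*\<^bsub>parent_tree\<^esub> par x" using par[OF less.prems False] by (intro less.hyps) auto
      moreover have "par x \<rightarrow>\<^bsub>parent_tree\<^esub> x"
        using par[OF less.prems False] less.prems False unfolding dominates_parent_tree by simp
      ultimately show ?thesis by (rule P.reachable_adj_trans)
    qed
  qed
  have "connected parent_tree"
  proof (rule P.connectedI)
    show "verts parent_tree \<noteq> {}" using root by (auto simp: verts_parent_tree)
    fix u v assume "u \<in> verts parent_tree" "v \<in> verts parent_tree"
    then have "\<rho> \<rightarrow>\<^sup>*\<^bsub>parent_tree\<^esub> u" "\<rho> \<rightarrow>\<^sup>*\<^bsub>parent_tree\<^esub> v"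
      using reach by (simp_all add: verts_parent_tree)
    then have "u \<rightarrow>\<^sup>*\<^bsub>parent_tree\<^esub> v" using P.symmetric_reachable' P.reachable_trans by blast
    then show "u \<rightarrow>\<^sup>*\<^bsub>mk_symmetric parent_tree\<^esub> v" by (rule P.reachable_mk_symmetricI)
  qed
  then show ?thesis
    unfolding rooted_tree_def using undirected_acyclic_parent_tree root P.graph_axioms graph_parent_tree
    by (simp add: verts_parent_tree)
qed

text \<open>A path from the root has one vertex more than the height of its end, and a vertex of
  greatest height has no children, hence is a leaf.\<close>

lemma tree_depth_parent_tree:
  assumes le: "\<And>x. x \<in> V \<Longrightarrow> h x \<le> D" and v: "v \<in> V" "h v = D"
  shows "tree_depth parent_tree \<rho> = Suc D"
proof -
  let ?L = "{length p | p. vpath p parent_tree \<and> hd p = \<rho> \<and> tree_leaf parent_tree \<rho> (last p)}"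
  have len: "length p = Suc (h (last p)) \<and> last p \<in> V" if "vpath p parent_tree" "hd p = \<rho>" for p
  proof -
    have "p \<noteq> []" "set p \<subseteq> V" using that by (auto simp: vpath_iff_vpath_on vpath_on_def verts_parent_tree)
    then show ?thesis using parent_tree_path_height[OF that, of "length p - 1"] last_in_set[of p]
      by (auto simp: last_conv_nth)
  qed
  obtain p where p: "vpath p parent_tree" "hd p = \<rho>" "last p = v"
    using rooted_tree_ex_path[OF rooted_tree_parent_tree] v(1) verts_parent_tree by blast
  have out: "out_arcs parent_tree v = {(v, y) | y. v \<rightarrow>\<^bsub>parent_tree\<^esub> y}"
    by (auto simp: out_arcs_def parent_tree_def)
  have down: "y = par v \<and> v \<noteq> \<rho>" if "v \<rightarrow>\<^bsub>parent_tree\<^esub> y" for y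
    using parent_tree_lower_neighbour[OF that] le[of y] v(2) that unfolding dominates_parent_tree by auto
  have "tree_leaf parent_tree \<rho> v"
  proof (cases "v = \<rho>")
    case True
    then have "out_arcs parent_tree v = {}" using out down by blast
    then show ?thesis using True v(1) by (simp add: tree_leaf_def out_degree_def verts_parent_tree)
  next
    case False
    then have "v \<rightarrow>\<^bsub>parent_tree\<^esub> par v" using par[OF v(1) False] v(1) by (simp add: dominates_parent_tree)
    then have "{y. v \<rightarrow>\<^bsub>parent_tree\<^esub> y} = {par v}" using down by blast
    then have "out_arcs parent_tree v = {(v, par v)}" unfolding out by blast
    then show ?thesis using False v(1) by (simp add: tree_leaf_def out_degree_def verts_parent_tree)
  qed
  then have "Suc D \<in> ?L" using p len[OF p(1,2)] v(2) by (intro CollectI exI[of _ p]) simp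
  moreover have "x \<le> Suc D" if "x \<in> ?L" for x
  proof -
    from that obtain p where "x = length p" "vpath p parent_tree" "hd p = \<rho>" by blast
    then show ?thesis using len[of p] le[of "last p"] by simp
  qed
  moreover have "finite ?L" using calculation(2) unfolding finite_nat_set_iff_bounded_le by blast
  ultimately show ?thesis unfolding tree_depth_def by (intro Max_eqI) auto
qed

end

lemma finite_tree_nodes: "finite (tree_nodes d k)"
  using finite_lists_length_le[of "{..<k}" d] by (simp add: tree_nodes_def conj_commute)

text \<open>\<^const>\<open>tree_rank\<close> quantifies over trees on natural numbers, so encode the nodes of \<open>T\<^sup>d\<^sup>+\<^sup>1\<^sub>k\<close>.\<close>

lemma ex_nat_complete_tree:
  assumes "0 < k"
  shows "\<exists>(T :: (nat, nat \<times> nat) pre_digraph) \<rho> \<psi>. rooted_tree T \<rho> \<and> tree_depth T \<rho> = Suc d \<and>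
     inj_on \<psi> (tree_nodes d k) \<and> \<psi> ` tree_nodes d k \<subseteq> verts T \<and>
     (\<forall>u v. u \<rightarrow>\<^bsub>complete_tree (Suc d) k\<^esub> v \<longrightarrow> \<psi> u \<rightarrow>\<^bsub>T\<^esub> \<psi> v)"
proof -
  define V :: "nat set" where "V = to_nat ` tree_nodes d k"
  define \<rho> :: nat where "\<rho> = to_nat ([] :: nat list)"
  define par :: "nat \<Rightarrow> nat" where "par x = to_nat (tl (from_nat x :: nat list))" for x
  define h :: "nat \<Rightarrow> nat" where "h x = length (from_nat x :: nat list)" for x
  have 1: "finite V" by (simp add: V_def finite_tree_nodes)
  have 2: "\<rho> \<in> V" by (simp add: V_def \<rho>_def Nil_in_tree_nodes)
  have 3: "h \<rho> = 0" by (simp add: h_def \<rho>_def)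
  have 4: "par x \<in> V \<and> h x = Suc (h (par x))" if "x \<in> V" "x \<noteq> \<rho>" for x
  proof -
    from that obtain xs where xs: "xs \<in> tree_nodes d k" "x = to_nat xs" "xs \<noteq> []"
      by (auto simp: V_def \<rho>_def)
    then obtain y ys where "xs = y # ys" by (cases xs) auto
    with xs show ?thesis by (auto simp: V_def par_def h_def tree_nodes_def)
  qed
  interpret N: parent_function V \<rho> par h
    by unfold_locales (use 1 2 3 4 in auto)
  have "tree_depth N.parent_tree \<rho> = Suc d"
  proof (rule N.tree_depth_parent_tree)
    show "h x \<le> d" if "x \<in> V" for x using that by (auto simp: V_def h_def tree_nodes_def)
    \<comment> \<open>The node reached by always taking child 0, which exists as
      \<open>0 < k\<close>.\<close>
    show "to_nat (replicate d (0 :: nat)) \<in> V" using assms by (auto simp: V_def tree_nodes_def)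
    show "h (to_nat (replicate d (0 :: nat))) = d" by (simp add: h_def)
  qed
  moreover have "inj_on (to_nat :: nat list \<Rightarrow> nat) (tree_nodes d k)" by (simp add: inj_on_def)
  moreover have "(to_nat :: nat list \<Rightarrow> nat) ` tree_nodes d k \<subseteq> verts N.parent_tree"
    unfolding N.verts_parent_tree by (simp add: V_def)
  moreover have "\<forall>u v. u \<rightarrow>\<^bsub>complete_tree (Suc d) k\<^esub> v \<longrightarrow> to_nat u \<rightarrow>\<^bsub>N.parent_tree\<^esub> to_nat v"
    unfolding dominates_complete_tree N.dominates_parent_tree
    by (auto simp: V_def \<rho>_def par_def)
  moreover note N.rooted_tree_parent_tree
  ultimately show ?thesis by blast
qed

lemma wf_complete_tree: "wf_digraph (complete_tree d k)"
  by unfold_locales (auto simp: complete_tree_def Let_def)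

lemma tree_nodes_mono: "d \<le> d' \<Longrightarrow> k \<le> k' \<Longrightarrow> tree_nodes d k \<subseteq> tree_nodes d' k'"
  by (auto simp: tree_nodes_def)

lemma stm_complete_tree_antimono:
  assumes "shallow_topological_minor r (complete_tree (Suc d') k') G" "d \<le> d'" "k \<le> k'"
  shows "shallow_topological_minor r (complete_tree (Suc d) k) G"
proof (rule stm_embed[OF wf_complete_tree _ _ _ assms(1), where \<psi> = id])
  show "id ` verts (complete_tree (Suc d) k) \<subseteq> verts (complete_tree (Suc d') k')"
    using tree_nodes_mono[OF assms(2,3)] by (simp add: verts_complete_tree)
  show "id u \<rightarrow>\<^bsub>complete_tree (Suc d') k'\<^esub> id v" if "u \<rightarrow>\<^bsub>complete_tree (Suc d) k\<^esub> v" for u v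
    using that tree_nodes_mono[OF assms(2,3)] by (auto simp: dominates_complete_tree)
qed simp

section \<open>The equivalence\<close>

text \<open>If depth \<open>Suc d\<close> fails for \<open>r\<close>, then some tree is missing, and
  with it every complete tree that contains it. Conversely, a greater depth attained for
  \<open>r\<close> would yield a larger complete tree, which contains
  \<open>complete_tree (Suc d) k\<close>.\<close>

lemma tree_rank_le_iff:
  "tree_rank C \<le> enat d \<longleftrightarrow>
     (\<forall>r. \<exists>k. \<forall>G\<in>C. \<not> shallow_topological_minor r (complete_tree (Suc d) k) G)"
proof
  assume rank: "tree_rank C \<le> enat d"
  show "\<forall>r. \<exists>k. \<forall>G\<in>C. \<not> shallow_topological_minor r (complete_tree (Suc d) k) G"
  proof
    fix r
    have "\<not> enat (Suc d) \<le> tree_rank C" using rank by (metis enat_ord_simps(1) not_less_eq_eq order_refl order_trans)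
    then have "\<not> (\<forall>(T :: (nat, nat \<times> nat) pre_digraph) \<rho>. rooted_tree T \<rho> \<and> tree_depth T \<rho> = Suc d \<longrightarrow>
        (\<exists>G\<in>C. shallow_topological_minor r T G))"
      unfolding tree_rank_def by (rule contrapos_nn) (rule Sup_upper, blast)
    then obtain T :: "(nat, nat \<times> nat) pre_digraph" and \<rho> where T: "rooted_tree T \<rho>" "tree_depth T \<rho> = Suc d"
      and no: "\<And>G. G \<in> C \<Longrightarrow> \<not> shallow_topological_minor r T G" by blast
    from rooted_tree_embeds_complete_tree[OF T] obtain k \<psi> where \<psi>: "inj_on \<psi> (verts T)"
      "\<psi> ` verts T \<subseteq> verts (complete_tree (Suc d) k)"
      "\<And>u v. u \<rightarrow>\<^bsub>T\<^esub> v \<Longrightarrow> \<psi> u \<rightarrow>\<^bsub>complete_tree (Suc d) k\<^esub> \<psi> v" by blast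
    have "wf_digraph T" using T(1) by (auto simp: rooted_tree_def graph_def digraph_def fin_digraph_def)
    then have "\<not> shallow_topological_minor r (complete_tree (Suc d) k) G" if "G \<in> C" for G
      using stm_embed[OF _ \<psi>] no[OF that] by blast
    then show "\<exists>k. \<forall>G\<in>C. \<not> shallow_topological_minor r (complete_tree (Suc d) k) G" by blast
  qed
next
  assume no: "\<forall>r. \<exists>k. \<forall>G\<in>C. \<not> shallow_topological_minor r (complete_tree (Suc d) k) G"
  show "tree_rank C \<le> enat d"
    unfolding tree_rank_def
  proof (rule Sup_least, elim CollectE exE conjE)
    fix x d' r
    assume x: "x = enat d'" and all: "\<forall>(T :: (nat, nat \<times> nat) pre_digraph) \<rho>.
        rooted_tree T \<rho> \<and> tree_depth T \<rho> = d' \<longrightarrow> (\<exists>G\<in>C. shallow_topological_minor r T G)"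
    have "d' \<le> d"
    proof (rule ccontr)
      assume "\<not> d' \<le> d"
      then obtain e where e: "d' = Suc e" "d \<le> e" by (cases d') auto
      from no obtain k where k: "\<And>G. G \<in> C \<Longrightarrow> \<not> shallow_topological_minor r (complete_tree (Suc d) k) G" by blast
      \<comment> \<open>\<open>Suc k\<close> instead of \<open>k\<close>, since a complete tree has
        its nominal depth only with positive branching.\<close>
      obtain T :: "(nat, nat \<times> nat) pre_digraph" and \<rho> \<psi> where T: "rooted_tree T \<rho>" "tree_depth T \<rho> = Suc e"
        and \<psi>: "inj_on \<psi> (tree_nodes e (Suc k))" "\<psi> ` tree_nodes e (Suc k) \<subseteq> verts T"
          "\<And>u v. u \<rightarrow>\<^bsub>complete_tree (Suc e) (Suc k)\<^esub> v \<Longrightarrow> \<psi> u \<rightarrow>\<^bsub>T\<^esub> \<psi> v"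
        using ex_nat_complete_tree[of "Suc k" e] by auto
      from all T e(1) obtain G where G: "G \<in> C" "shallow_topological_minor r T G" by blast
      have "shallow_topological_minor r (complete_tree (Suc e) (Suc k)) G"
        by (rule stm_embed[OF wf_complete_tree _ _ \<psi>(3) G(2)]) (use \<psi> in \<open>simp_all add: verts_complete_tree\<close>)
      then have "shallow_topological_minor r (complete_tree (Suc d) k) G"
        by (rule stm_complete_tree_antimono) (use e in auto)
      then show False using k G(1) by blast
    qed
    then show "x \<le> enat d" using x by simp
  qed
qed

text \<open>Rewriting the bound as a strict one below \<open>Suc d\<close> extracts a witness d'
  \<le> d from the infimum. The same \<open>f\<close> then works for \<open>d\<close>, as a deeper
  complete tree contains the shallower one.\<close>

lemma elementary_tree_rank_le_iff:
  "elementary_tree_rank C \<le> enat d \<longleftrightarrow>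
     (\<exists>f. elementary f \<and> (\<forall>r. \<forall>G\<in>C. \<not> shallow_topological_minor r (complete_tree (Suc d) (f r)) G))"
  (is "_ \<longleftrightarrow> (\<exists>f. elementary f \<and> ?none d f)")
proof -
  have least: "(\<exists>x\<in>{enat d' | d'. Q d'}. x < enat (Suc d)) \<longleftrightarrow> (\<exists>d'\<le>d. Q d')" for Q
  proof
    assume "\<exists>d'\<le>d. Q d'"
    then obtain d' where "d' \<le> d" "Q d'" by blast
    then show "\<exists>x\<in>{enat d' | d'. Q d'}. x < enat (Suc d)"
      by (intro bexI[of _ "enat d'"]) auto
  qed (auto simp: less_Suc_eq_le)
  have "elementary_tree_rank C \<le> enat d \<longleftrightarrow> elementary_tree_rank C < enat (Suc d)"
    by (cases "elementary_tree_rank C") (simp_all add: less_Suc_eq_le)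
  also have "\<dots> \<longleftrightarrow> (\<exists>d'\<le>d. \<exists>f. elementary f \<and> ?none d' f)"
    unfolding elementary_tree_rank_def Inf_less_iff least by simp
  also have "\<dots> \<longleftrightarrow> (\<exists>f. elementary f \<and> ?none d f)"
    using stm_complete_tree_antimono by blast
  finally show ?thesis .
qed

lemma splitter_wins_if_no_stm:
  assumes G: "graph G" and "\<not> shallow_topological_minor r (complete_tree (Suc d) k) G"
  shows "splitter_wins (batch_bound r k d) r d G"
proof -
  interpret graph G by (rule G)
  from assms(2) have "\<not> (\<exists>u A. sdtree (dominates G) r k (verts G) d u A)"
    unfolding stm_complete_tree_iff_sdtree[OF sym_arcs] .
  from no_sdtree_imp_wins_on[OF this order_refl] show ?thesis
    unfolding splitter_wins_iff[OF wf_digraph] .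
qed

text \<open>\<open>Suc m\<close> branches outnumber a batch, and \<open>d\<close> levels of paths
  with at most \<open>r + 1\<close> edges fit into the radius.\<close>

lemma no_stm_if_splitter_wins:
  assumes G: "graph G" and "splitter_wins m (d * (r + 1)) d G"
  shows "\<not> shallow_topological_minor r (complete_tree (Suc d) (Suc m)) G"
proof -
  interpret graph G by (rule G)
  from assms(2) show ?thesis
    unfolding splitter_wins_iff[OF wf_digraph] stm_complete_tree_iff_sdtree[OF sym_arcs]
    using sdtree_imp_not_wins_on[of "dominates G" r "Suc m" "verts G" d _ _ m "d * (r + 1)"] by auto
qed

text \<open>Ranks are compared by \<open>\<le>\<close>: a win in \<open>d\<close> rounds is also a
  win in more rounds, so the game can only express an upper bound.\<close>

theorem theorem4p1:
  fixes C :: "('a, 'b) pre_digraph set" and d :: nat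
  assumes "d \<ge> 1"
    and "\<And>G. G \<in> C \<Longrightarrow> graph G"
  shows "(tree_rank C \<le> enat d \<longleftrightarrow>
           (\<exists>g :: nat \<Rightarrow> nat. \<forall>r. \<forall>G\<in>C. splitter_wins (g r) r d G)) \<and>
         (elementary_tree_rank C \<le> enat d \<longleftrightarrow>
           (\<exists>g :: nat \<Rightarrow> nat. elementary g \<and> (\<forall>r. \<forall>G\<in>C. splitter_wins (g r) r d G)))"
proof -
  let ?minor = "\<lambda>r k G. shallow_topological_minor r (complete_tree (Suc d) k) G"
  have wins: "\<forall>r. \<forall>G\<in>C. splitter_wins (batch_bound r (f r) d) r d G" if "\<forall>r. \<forall>G\<in>C. \<not> ?minor r (f r) G" for f
    using that assms(2) splitter_wins_if_no_stm by blast
  \<comment> \<open>Minors of shallowness \<open>r\<close> are excluded by the game of the larger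
    radius \<open>d * (r + 1)\<close>, so \<open>g\<close> is evaluated there.\<close>
  have minor: "\<forall>r. \<forall>G\<in>C. \<not> ?minor r (Suc (g (d * (r + 1)))) G" if "\<forall>r. \<forall>G\<in>C. splitter_wins (g r) r d G" for g
    using that assms(2) no_stm_if_splitter_wins by blast
  \<comment> \<open>Both ranks now ask for a function \<open>f\<close> from \<open>r\<close> to the
    branching; without the elementary bound it comes from choice.\<close>
  have "tree_rank C \<le> enat d \<longleftrightarrow> (\<exists>f. \<forall>r. \<forall>G\<in>C. \<not> ?minor r (f r) G)"
    unfolding tree_rank_le_iff by (rule choice_iff)
  also have "\<dots> \<longleftrightarrow> (\<exists>g. \<forall>r. \<forall>G\<in>C. splitter_wins (g r) r d G)"
    by (intro iffI; elim exE) (rule exI, erule wins, rule exI, erule minor)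
  finally have "tree_rank C \<le> enat d \<longleftrightarrow> (\<exists>g. \<forall>r. \<forall>G\<in>C. splitter_wins (g r) r d G)" .
  moreover have "elementary_tree_rank C \<le> enat d \<longleftrightarrow>
      (\<exists>g. elementary g \<and> (\<forall>r. \<forall>G\<in>C. splitter_wins (g r) r d G))"
    unfolding elementary_tree_rank_le_iff
  proof (intro iffI; elim exE conjE)
    fix f assume "elementary f" and f: "\<forall>r. \<forall>G\<in>C. \<not> ?minor r (f r) G"
    then have "elementary (\<lambda>r. batch_bound r (f r) d)" by (intro elementary_batch_bound)
    then show "\<exists>g. elementary g \<and> (\<forall>r. \<forall>G\<in>C. splitter_wins (g r) r d G)"
      using wins[OF f] by (intro exI conjI)
  next
    fix g assume g: "elementary g" and win: "\<forall>r. \<forall>G\<in>C. splitter_wins (g r) r d G"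
    have "elementary (\<lambda>r. Suc (g (d * (r + 1))))"
      by (intro elementary_intros elementary_comp[OF g])
    then show "\<exists>f. elementary f \<and> (\<forall>r. \<forall>G\<in>C. \<not> ?minor r (f r) G)"
      using minor[OF win] by (intro exI conjI)
  qed
  ultimately show ?thesis ..
qed

end
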